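(* Let $N\in\mathbb{N}$ and let $\Omega\subset\mathbb{R}^N$ be a bounded domain with connected Lipschitz boundary $\Gamma:=\partial\Omega$. Let $c_m>0$ be a Maxwell constant for $\Omega$, i.e. a positive constant such that $$\|v\|_{L^2(\Omega)}\le c_m\big(\|\operatorname{curl}v\|_{L^2(\Omega)}^2+\|\operatorname{div}v\|_{L^2(\Omega)}^2\big)^{1/2}\qquad\text{for all }v\in \mathring{H}(\operatorname{curl};\Omega)\cap H(\operatorname{div};\Omega),$$ and set $\hat c:=\max\{2,\sqrt5\,c_m\}$. Then for all tensor fields $P\in\mathring{H}(\operatorname{Curl};\Omega)$ $$\|P\|_{L^2(\Omega)}\le\hat c\,\big(\|\operatorname{sym}P\|_{L^2(\Omega)}^2+\|\operatorname{Curl}P\|_{L^2(\Omega)}^2\big)^{1/2}.$$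
   Context: All functions are real-valued and $L^2(\Omega)$ denotes $L^2(\Omega,\mathbb{R}^k)$ for the appropriate $k$, with the Euclidean (for matrices: Frobenius) norm on values. For a vector field $v:\Omega\to\mathbb{R}^N$, $\operatorname{curl}v$ is the $\mathbb{R}^{(N-1)N/2}$-valued field with entries $\partial_n v_m-\partial_m v_n$, $1\le n<m\le N$ (the exterior derivative of the $1$-form identified with $v$), and $\operatorname{div}v=\sum_n\partial_n v_n$; both are understood in the weak (distributional) sense. Define $$H(\operatorname{curl};\Omega):=\{v\in L^2(\Omega,\mathbb{R}^N):\operatorname{curl}v\in L^2(\Omega,\mathbb{R}^{(N-1)N/2})\},$$ $$H(\operatorname{div};\Omega):=\{v\in L^2(\Omega,\mathbb{R}^N):\operatorname{div}v\in L^2(\Omega,\mathbb{R})\},$$ and let $\mathring{H}(\operatorname{curl};\Omega)$ be the closure of the compactly supported smooth vector fields $C_c^\infty(\Omega,\mathbb{R}^N)$ in $H(\operatorname{curl};\Omega)$ with respect to the graph norm $(\|v\|_{L^2(\Omega)}^2+\|\operatorname{curl}v\|_{L^2(\Omega)}^2)^{1/2}$; this generalizes the homogeneous tangential boundary condition on $\Gamma$. For the domains considered, a constant $c_m$ as in the claim exists. For a tensor field $P:\Omega\to\mathbb{R}^{N\times N}$ with rows $P_1,\dots,P_N$, $\operatorname{Curl}P$ is the $N\times(N-1)N/2$ tensor field whose $n$-th row is $\operatorname{curl}P_n$. $\mathring{H}(\operatorname{Curl};\Omega)$ is the space of tensor fields all of whose rows belong to $\mathring{H}(\operatorname{curl};\Omega)$.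 Finally $\operatorname{sym}P:=\frac12(P+P^T)$. *)

theory Defs
  imports "HOL-Analysis.Analysis"
begin

text \<open>
  Fields on \<open>\<Omega>\<close> are total functions on \<open>real ^ 'n\<close>; only their values on \<open>\<Omega>\<close>, up to null
  sets, are relevant. The space dimension is \<open>N = CARD('n)\<close>, and the linear order on the index
  type serves to single out the pairs \<open>n < m\<close> in the curl.
\<close>

type_synonym 'n point = "(real, 'n) vec"
type_synonym 'n matrix = "((real, 'n) vec, 'n) vec"
type_synonym 'n tensor = "(((real, 'n) vec, 'n) vec, 'n) vec"

subsection \<open>Lipschitz domains\<close>

text \<open>
  Near each boundary point, \<open>\<Omega>\<close> is the strict subgraph, in some unit direction \<open>e\<close>, of a
  Lipschitz function \<open>g\<close> on the hyperplane orthogonal to \<open>e\<close> (a copy of \<open>(N-1)\<close>-space). As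
  \<open>\<Omega>\<close> coincides with the subgraph on the whole neighbourhood \<open>U\<close>, it lies locally on one
  side of its boundary.
\<close>

definition lipschitz_boundary :: "'a::euclidean_space set \<Rightarrow> bool" where
  "lipschitz_boundary \<Omega> \<longleftrightarrow>
     (\<forall>x0\<in>frontier \<Omega>. \<exists>U e g L.
        open U \<and> x0 \<in> U \<and> norm e = 1 \<and> L-lipschitz_on {y. y \<bullet> e = 0} (g :: 'a \<Rightarrow> real) \<and>
        \<Omega> \<inter> U = {x \<in> U. x \<bullet> e < g (x - (x \<bullet> e) *\<^sub>R e)})"

definition bounded_domain :: "'a::euclidean_space set \<Rightarrow> bool" where
  "bounded_domain \<Omega> \<longleftrightarrow> open \<Omega> \<and> connected \<Omega> \<and> \<Omega> \<noteq> {} \<and> bounded \<Omega>"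

subsection \<open>Test functions\<close>

definition partial_deriv :: "'n \<Rightarrow> (real ^ 'n \<Rightarrow> 'b::real_normed_vector) \<Rightarrow> real ^ 'n \<Rightarrow> 'b" where
  "partial_deriv i f x = frechet_derivative f (at x) (axis i 1)"

primrec C_k :: "nat \<Rightarrow> (real ^ 'n \<Rightarrow> 'b::real_normed_vector) \<Rightarrow> bool" where
  "C_k 0 f \<longleftrightarrow> continuous_on UNIV f"
| "C_k (Suc k) f \<longleftrightarrow> (\<forall>x. f differentiable (at x)) \<and> (\<forall>i. C_k k (partial_deriv i f))"

text \<open>A compactly supported smooth function on \<open>\<Omega>\<close> is identified with its extension by zero.\<close>

definition test_functions :: "(real ^ 'n) set \<Rightarrow> (real ^ 'n \<Rightarrow> 'b::real_normed_vector) set" where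
  "test_functions \<Omega> =
     {\<phi>. (\<forall>k. C_k k \<phi>) \<and> compact (closure {x. \<phi> x \<noteq> 0}) \<and> closure {x. \<phi> x \<noteq> 0} \<subseteq> \<Omega>}"

subsection \<open>Square-integrable fields\<close>

text \<open>
  For matrix and third-order tensor values, the norm of \<open>real ^ 'n ^ 'm\<close> is the Frobenius norm.
\<close>

definition L2 :: "'a::euclidean_space set \<Rightarrow> ('a \<Rightarrow> 'b::euclidean_space) set" where
  "L2 \<Omega> = {f \<in> borel_measurable (lebesgue_on \<Omega>). integrable (lebesgue_on \<Omega>) (\<lambda>x. (norm (f x))\<^sup>2)}"

definition L2_norm :: "'a::euclidean_space set \<Rightarrow> ('a \<Rightarrow> 'b::euclidean_space) \<Rightarrow> real" where
  "L2_norm \<Omega> f = sqrt (LINT x|lebesgue_on \<Omega>. (norm (f x))\<^sup>2)"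

subsection \<open>Weak curl and divergence\<close>

text \<open>
  A vector with \<open>(N-1)N/2\<close> entries indexed by the pairs \<open>n < m\<close> is stored as the strictly upper
  triangular matrix with these entries. The Frobenius norm of that matrix is the Euclidean norm
  of the vector.
\<close>

definition has_weak_curl ::
  "'n::{finite,linorder} point set \<Rightarrow> ('n point \<Rightarrow> 'n point) \<Rightarrow> ('n point \<Rightarrow> 'n matrix) \<Rightarrow> bool"
  where
  "has_weak_curl \<Omega> v w \<longleftrightarrow>
     (\<forall>n m. n < m \<longrightarrow> (\<forall>\<phi>\<in>test_functions \<Omega>.
        (LINT x|lebesgue_on \<Omega>. w x $ n $ m * \<phi> x) =
        - (LINT x|lebesgue_on \<Omega>. v x $ m * partial_deriv n \<phi> x - v x $ n * partial_deriv m \<phi> x))) \<and>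
     (\<forall>n m. \<not> n < m \<longrightarrow> (\<forall>x\<in>\<Omega>. w x $ n $ m = 0))"

definition has_weak_div ::
  "(real ^ 'n) set \<Rightarrow> (real ^ 'n \<Rightarrow> real ^ 'n) \<Rightarrow> (real ^ 'n \<Rightarrow> real) \<Rightarrow> bool" where
  "has_weak_div \<Omega> v d \<longleftrightarrow>
     (\<forall>\<phi>\<in>test_functions \<Omega>.
        (LINT x|lebesgue_on \<Omega>. d x * \<phi> x) =
        - (LINT x|lebesgue_on \<Omega>. (\<Sum>n\<in>UNIV. v x $ n * partial_deriv n \<phi> x)))"

definition H_curl :: "'n::{finite,linorder} point set \<Rightarrow> ('n point \<Rightarrow> 'n point) set" where
  "H_curl \<Omega> = {v \<in> L2 \<Omega>. \<exists>w\<in>L2 \<Omega>. has_weak_curl \<Omega> v w}"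

definition H_div :: "(real ^ 'n) set \<Rightarrow> (real ^ 'n \<Rightarrow> real ^ 'n) set" where
  "H_div \<Omega> = {v \<in> L2 \<Omega>. \<exists>d\<in>L2 \<Omega>. has_weak_div \<Omega> v d}"

text \<open>
  On open \<open>\<Omega>\<close> the weak curl of a field in \<open>H_curl \<Omega>\<close> and the weak divergence of a field in
  \<open>H_div \<Omega>\<close> are unique up to null sets, so the choice of representative below does not affect
  any norm.
\<close>

definition weak_curl ::
  "'n::{finite,linorder} point set \<Rightarrow> ('n point \<Rightarrow> 'n point) \<Rightarrow> 'n point \<Rightarrow> 'n matrix" where
  "weak_curl \<Omega> v = (SOME w. w \<in> L2 \<Omega> \<and> has_weak_curl \<Omega> v w)"

definition weak_div ::
  "(real ^ 'n) set \<Rightarrow> (real ^ 'n \<Rightarrow> real ^ 'n) \<Rightarrow> real ^ 'n \<Rightarrow> real" where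
  "weak_div \<Omega> v = (SOME d. d \<in> L2 \<Omega> \<and> has_weak_div \<Omega> v d)"

definition curl_graph_norm ::
  "'n::{finite,linorder} point set \<Rightarrow> ('n point \<Rightarrow> 'n point) \<Rightarrow> real" where
  "curl_graph_norm \<Omega> v = sqrt ((L2_norm \<Omega> v)\<^sup>2 + (L2_norm \<Omega> (weak_curl \<Omega> v))\<^sup>2)"

definition H0_curl :: "'n::{finite,linorder} point set \<Rightarrow> ('n point \<Rightarrow> 'n point) set" where
  "H0_curl \<Omega> =
     {v \<in> H_curl \<Omega>. \<forall>\<epsilon>>0. \<exists>\<phi>\<in>test_functions \<Omega>. curl_graph_norm \<Omega> (\<lambda>x. v x - \<phi> x) < \<epsilon>}"

subsection \<open>Tensor fields\<close>

definition H0_Curl :: "'n::{finite,linorder} point set \<Rightarrow> ('n point \<Rightarrow> 'n matrix) set" where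
  "H0_Curl \<Omega> = {P. \<forall>n. (\<lambda>x. P x $ n) \<in> H0_curl \<Omega>}"

definition weak_Curl ::
  "'n::{finite,linorder} point set \<Rightarrow> ('n point \<Rightarrow> 'n matrix) \<Rightarrow> 'n point \<Rightarrow> 'n tensor"
  where
  "weak_Curl \<Omega> P x = (\<chi> n. weak_curl \<Omega> (\<lambda>y. P y $ n) x)"

definition sym_part :: "real ^ 'n ^ 'n \<Rightarrow> real ^ 'n ^ 'n" where
  "sym_part A = (1 / 2) *\<^sub>R (A + transpose A)"

end

theory Submission
  imports Defs
begin

text \<open>
  The inequality combines a Helmholtz decomposition of the rows of \<open>P\<close> with Korn's first
  inequality for the gradient part and the Maxwell inequality for the solenoidal part.

  Let \<open>g\<^sub>n\<close> be the \<open>L\<^sup>2\<close>-orthogonal projection of the row \<open>P\<^sub>n\<close> onto the closure of the gradients of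
  test functions, and let \<open>s\<^sub>n = P\<^sub>n - g\<^sub>n\<close>. Write \<open>G\<close> and \<open>S\<close> for the tensor fields with these
  rows, so that \<open>\<parallel>P\<parallel>\<^sup>2 = \<parallel>G\<parallel>\<^sup>2 + \<parallel>S\<parallel>\<^sup>2\<close>.

  The rows of \<open>S\<close> are orthogonal to all gradients of test functions, that is, they have divergence
  zero. Limits of gradients are curl free, so \<open>s\<^sub>n\<close> has the curl of \<open>P\<^sub>n\<close> and stays in the closure
  of the test fields (\<open>H0_curl_diff_gradient\<close>). The Maxwell inequality then gives
  \<open>\<parallel>S\<parallel> \<le> c\<^sub>m \<parallel>Curl P\<parallel>\<close>.

  For \<open>G\<close>, Korn's first inequality \<open>\<parallel>G\<parallel>\<^sup>2 \<le> 2 \<parallel>sym G\<parallel>\<^sup>2\<close> holds with an explicit constant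
  (\<open>Korn_L2_gradients\<close>). Since \<open>sym G = sym P - sym S\<close>, it follows that
  \<open>\<parallel>P\<parallel>\<^sup>2 \<le> 2 \<parallel>sym G\<parallel>\<^sup>2 + \<parallel>S\<parallel>\<^sup>2 \<le> 4 \<parallel>sym P\<parallel>\<^sup>2 + 5 \<parallel>S\<parallel>\<^sup>2 \<le> 4 \<parallel>sym P\<parallel>\<^sup>2 + 5 c\<^sub>m\<^sup>2 \<parallel>Curl P\<parallel>\<^sup>2\<close>,
  and both coefficients are at most the square of \<open>max 2 (sqrt 5 * c\<^sub>m)\<close>.

  Three ingredients carry this argument. The projection exists because \<open>L\<^sup>2\<close> is complete
  (\<open>L2_complete\<close>, \<open>L2_gradient_projection\<close>). Both the curl invariance and Korn's inequality rest on
  the identity \<open>\<integral> \<partial>\<^sub>i u \<partial>\<^sub>j v = \<integral> \<partial>\<^sub>j u \<partial>\<^sub>i v\<close> for test functions (\<open>test_function_gradient_swap\<close>) and its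
  extension to limits of gradients (\<open>L2_gradients_swap\<close>). Finally, the divergence in the Maxwell
  inequality is an arbitrarily chosen representative, and the fundamental lemma of the calculus of
  variations (\<open>fundamental_lemma_variations\<close>) shows that every representative of the zero
  divergence vanishes almost everywhere.
\<close>

section \<open>Square-integrable fields as a complete inner product space\<close>

definition L2_inner ::
  "'a::euclidean_space set \<Rightarrow> ('a \<Rightarrow> 'b::euclidean_space) \<Rightarrow> ('a \<Rightarrow> 'b) \<Rightarrow> real" where
  "L2_inner \<Omega> f g = (LINT x|lebesgue_on \<Omega>. f x \<bullet> g x)"

lemma L2_measurable: "f \<in> L2 \<Omega> \<Longrightarrow> f \<in> borel_measurable (lebesgue_on \<Omega>)"
  by (simp add: L2_def)

lemma integrable_inner_L2:
  assumes "f \<in> L2 \<Omega>" "g \<in> L2 \<Omega>"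
  shows "integrable (lebesgue_on \<Omega>) (\<lambda>x. f x \<bullet> g x)"
proof (rule Bochner_Integration.integrable_bound)
  show "integrable (lebesgue_on \<Omega>) (\<lambda>x. (norm (f x))\<^sup>2 + (norm (g x))\<^sup>2)"
    using assms by (simp add: L2_def)
  show "(\<lambda>x. f x \<bullet> g x) \<in> borel_measurable (lebesgue_on \<Omega>)"
    using assms by (intro borel_measurable_inner L2_measurable)
  have "\<bar>a \<bullet> b\<bar> \<le> (norm a)\<^sup>2 + (norm b)\<^sup>2" for a b :: 'b
  proof -
    have "2 * \<bar>a \<bullet> b\<bar> \<le> 2 * (norm a * norm b)"
      using Cauchy_Schwarz_ineq2[of a b] by simp
    also have "\<dots> \<le> (norm a)\<^sup>2 + (norm b)\<^sup>2"
      using sum_squares_bound[of "norm a" "norm b"] by simp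
    finally show ?thesis by (smt (verit) zero_le_power2)
  qed
  then show "AE x in lebesgue_on \<Omega>.
      norm (f x \<bullet> g x) \<le> norm ((norm (f x))\<^sup>2 + (norm (g x))\<^sup>2)"
    by auto
qed

lemma L2_add:
  assumes "f \<in> L2 \<Omega>" "g \<in> L2 \<Omega>"
  shows "(\<lambda>x. f x + g x) \<in> L2 \<Omega>"
proof -
  have "(\<lambda>x. (norm (f x + g x))\<^sup>2) = (\<lambda>x. (norm (f x))\<^sup>2 + (norm (g x))\<^sup>2 + 2 * (f x \<bullet> g x))"
    by (simp add: fun_eq_iff power2_norm_eq_inner inner_add_left inner_add_right inner_commute)
  then show ?thesis
    using assms integrable_inner_L2[OF assms] by (auto simp: L2_def intro: borel_measurable_add)
qed

lemma L2_linear_image: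
  fixes f :: "'a::euclidean_space \<Rightarrow> 'b::euclidean_space" and T :: "'b \<Rightarrow> 'c::euclidean_space"
  assumes "linear T" "f \<in> L2 \<Omega>"
  shows "(\<lambda>x. T (f x)) \<in> L2 \<Omega>"
proof -
  obtain K where K: "\<And>y. norm (T y) \<le> K * norm y"
    using linear_bounded[OF assms(1)] by auto
  have T: "T \<in> borel_measurable borel"
    using linear_continuous_on[OF linear_linear[THEN iffD2, OF assms(1)]]
    by (intro borel_measurable_continuous_onI) auto
  have m: "(\<lambda>x. T (f x)) \<in> borel_measurable (lebesgue_on \<Omega>)"
    using measurable_compose[OF L2_measurable[OF assms(2)] T] .
  have "integrable (lebesgue_on \<Omega>) (\<lambda>x. (norm (T (f x)))\<^sup>2)"
  proof (rule Bochner_Integration.integrable_bound)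
    show "integrable (lebesgue_on \<Omega>) (\<lambda>x. K\<^sup>2 * (norm (f x))\<^sup>2)"
      using assms(2) by (simp add: L2_def)
    show "(\<lambda>x. (norm (T (f x)))\<^sup>2) \<in> borel_measurable (lebesgue_on \<Omega>)"
      using m by measurable
    show "AE x in lebesgue_on \<Omega>. norm ((norm (T (f x)))\<^sup>2) \<le> norm (K\<^sup>2 * (norm (f x))\<^sup>2)"
      using power_mono[OF K] by (auto simp: power_mult_distrib)
  qed
  with m show ?thesis by (simp add: L2_def)
qed

lemma L2_scaleR: "f \<in> L2 \<Omega> \<Longrightarrow> (\<lambda>x. c *\<^sub>R f x) \<in> L2 \<Omega>"
  by (rule L2_linear_image[of "\<lambda>y. c *\<^sub>R y"]) auto

lemma L2_diff:
  assumes "f \<in> L2 \<Omega>" "g \<in> L2 \<Omega>"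
  shows "(\<lambda>x. f x - g x) \<in> L2 \<Omega>"
  using L2_add[OF assms(1) L2_scaleR[OF assms(2), of "-1"]] by simp

lemma L2_component:
  fixes f :: "'a::euclidean_space \<Rightarrow> 'b::euclidean_space ^ 'n"
  shows "f \<in> L2 \<Omega> \<Longrightarrow> (\<lambda>x. f x $ i) \<in> L2 \<Omega>"
  by (rule L2_linear_image[of "\<lambda>y. y $ i"]) (auto intro: linearI)

lemma L2_sum:
  "finite I \<Longrightarrow> (\<And>i. i \<in> I \<Longrightarrow> f i \<in> L2 \<Omega>) \<Longrightarrow> (\<lambda>x. \<Sum>i\<in>I. f i x) \<in> L2 \<Omega>"
proof (induction I rule: finite_induct)
  case empty
  show ?case by (simp add: L2_def)
qed (auto intro: L2_add)

lemma L2_vec: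
  fixes f :: "'n::finite \<Rightarrow> 'a::euclidean_space \<Rightarrow> 'b::euclidean_space"
  assumes "\<And>i. f i \<in> L2 \<Omega>"
  shows "(\<lambda>x. \<chi> i. f i x) \<in> L2 \<Omega>"
proof -
  have "(\<lambda>x. axis i (f i x)) \<in> L2 \<Omega>" for i
    using assms by (intro L2_linear_image[of "axis i"] linearI) (auto simp: axis_def vec_eq_iff)
  moreover have "(\<lambda>x. \<chi> i. f i x) = (\<lambda>x. \<Sum>i\<in>UNIV. axis i (f i x))"
    by (simp add: fun_eq_iff vec_eq_iff axis_def if_distrib cong: if_cong)
  ultimately show ?thesis by (simp add: L2_sum)
qed

lemma L2_inner_commute: "L2_inner \<Omega> f g = L2_inner \<Omega> g f"
  by (simp add: L2_inner_def inner_commute)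

lemma L2_inner_diff_left:
  assumes "f \<in> L2 \<Omega>" "g \<in> L2 \<Omega>" "h \<in> L2 \<Omega>"
  shows "L2_inner \<Omega> (\<lambda>x. f x - g x) h = L2_inner \<Omega> f h - L2_inner \<Omega> g h"
  using assms by (simp add: L2_inner_def inner_diff_left integrable_inner_L2)

lemma L2_norm_nonneg [simp]: "0 \<le> L2_norm \<Omega> f"
  by (simp add: L2_norm_def)

lemma power2_L2_norm: "(L2_norm \<Omega> f)\<^sup>2 = L2_inner \<Omega> f f"
  by (simp add: L2_norm_def L2_inner_def power2_norm_eq_inner)

lemma power2_L2_norm_add_scaleR:
  assumes "f \<in> L2 \<Omega>" "g \<in> L2 \<Omega>"
  shows "(L2_norm \<Omega> (\<lambda>x. f x + t *\<^sub>R g x))\<^sup>2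
    = (L2_norm \<Omega> f)\<^sup>2 + 2 * t * L2_inner \<Omega> f g + t\<^sup>2 * (L2_norm \<Omega> g)\<^sup>2"
proof -
  have "(f x + t *\<^sub>R g x) \<bullet> (f x + t *\<^sub>R g x)
      = f x \<bullet> f x + 2 * t * (f x \<bullet> g x) + t\<^sup>2 * (g x \<bullet> g x)" for x
    by (simp add: inner_add_left inner_add_right inner_commute power2_eq_square algebra_simps)
  then show ?thesis
    using assms by (simp add: power2_L2_norm L2_inner_def integrable_inner_L2)
qed

lemma L2_inner_vec:
  fixes f g :: "'a::euclidean_space \<Rightarrow> 'b::euclidean_space ^ 'n"
  assumes "f \<in> L2 \<Omega>" "g \<in> L2 \<Omega>"
  shows "L2_inner \<Omega> f g = (\<Sum>i\<in>UNIV. L2_inner \<Omega> (\<lambda>x. f x $ i) (\<lambda>x. g x $ i))"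
  unfolding L2_inner_def inner_vec_def
  by (intro Bochner_Integration.integral_sum integrable_inner_L2 L2_component assms)

lemma power2_L2_norm_vec:
  fixes f :: "'a::euclidean_space \<Rightarrow> 'b::euclidean_space ^ 'n"
  assumes "f \<in> L2 \<Omega>"
  shows "(L2_norm \<Omega> f)\<^sup>2 = (\<Sum>i\<in>UNIV. (L2_norm \<Omega> (\<lambda>x. f x $ i))\<^sup>2)"
  by (simp add: power2_L2_norm L2_inner_vec assms)

lemma L2_norm_mono:
  assumes "f \<in> L2 \<Omega>" "g \<in> L2 \<Omega>" "\<And>x. norm (f x) \<le> norm (g x)"
  shows "L2_norm \<Omega> f \<le> L2_norm \<Omega> g"
  unfolding L2_norm_def using assms
  by (intro real_sqrt_le_mono integral_mono) (auto simp: L2_def intro: power_mono)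

text \<open>
  Besides the Cauchy-Schwarz inequality, this yields the orthogonality of a minimizer: for \<open>a = 0\<close>
  the conclusion is \<open>b = 0\<close>.
\<close>

lemma nonneg_quadratic_imp_discriminant:
  fixes a b c :: real
  assumes "0 \<le> c" "\<And>t. 0 \<le> a + 2 * t * b + t\<^sup>2 * c"
  shows "b\<^sup>2 \<le> a * c"
proof (cases "c = 0")
  case True
  have "b = 0"
  proof (rule ccontr)
    assume "b \<noteq> 0"
    then show False
      using assms(2)[of "- (a + 1) / (2 * b)"] True by (simp add: field_simps)
  qed
  then show ?thesis using True by simp
next
  case False
  with assms(1) have "c > 0" by simp
  then show ?thesis
    using assms(2)[of "- b / c"] by (simp add: field_simps power2_eq_square)
qed

lemma L2_Cauchy_Schwarz:
  assumes "f \<in> L2 \<Omega>" "g \<in> L2 \<Omega>"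
  shows "\<bar>L2_inner \<Omega> f g\<bar> \<le> L2_norm \<Omega> f * L2_norm \<Omega> g"
proof -
  have "(L2_inner \<Omega> f g)\<^sup>2 \<le> (L2_norm \<Omega> f)\<^sup>2 * (L2_norm \<Omega> g)\<^sup>2"
    by (rule nonneg_quadratic_imp_discriminant, simp)
      (metis power2_L2_norm_add_scaleR[OF assms] zero_le_power2)
  then show ?thesis
    by (metis abs_le_square_iff abs_of_nonneg L2_norm_nonneg mult_nonneg_nonneg power_mult_distrib)
qed

lemma L2_triangle:
  assumes "f \<in> L2 \<Omega>" "g \<in> L2 \<Omega>"
  shows "L2_norm \<Omega> (\<lambda>x. f x + g x) \<le> L2_norm \<Omega> f + L2_norm \<Omega> g"
proof (rule power2_le_imp_le)
  have "(L2_norm \<Omega> (\<lambda>x. f x + g x))\<^sup>2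
      = (L2_norm \<Omega> f)\<^sup>2 + 2 * L2_inner \<Omega> f g + (L2_norm \<Omega> g)\<^sup>2"
    using power2_L2_norm_add_scaleR[OF assms, of 1] by simp
  also have "\<dots> \<le> (L2_norm \<Omega> f + L2_norm \<Omega> g)\<^sup>2"
    using L2_Cauchy_Schwarz[OF assms] by (simp add: power2_sum)
  finally show "(L2_norm \<Omega> (\<lambda>x. f x + g x))\<^sup>2 \<le> (L2_norm \<Omega> f + L2_norm \<Omega> g)\<^sup>2" .
qed simp

lemma L2_triangle_diff:
  assumes "f \<in> L2 \<Omega>" "g \<in> L2 \<Omega>"
  shows "L2_norm \<Omega> (\<lambda>x. f x - g x) \<le> L2_norm \<Omega> f + L2_norm \<Omega> g"
proof -
  have "L2_norm \<Omega> (\<lambda>x. (- 1) *\<^sub>R g x) = L2_norm \<Omega> g"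
    by (simp add: L2_norm_def)
  then show ?thesis
    using L2_triangle[OF assms(1) L2_scaleR[OF assms(2), of "- 1"]] by simp
qed

lemma L2_norm_cong_ae_zero: "AE x in lebesgue_on \<Omega>. f x = 0 \<Longrightarrow> L2_norm \<Omega> f = 0"
  unfolding L2_norm_def by (subst integral_eq_zero_AE) auto

lemma const_in_L2:
  assumes "\<Omega> \<in> lmeasurable"
  shows "(\<lambda>x. c) \<in> L2 \<Omega>"
  using finite_measure.integrable_const[OF finite_measure_lebesgue_on[OF assms]]
  by (simp add: L2_def)

text \<open>
  On a set of finite measure this is the Cauchy-Schwarz inequality against the constant \<open>1\<close>. It turns
  \<open>L\<^sup>2\<close>-Cauchy sequences into \<open>L\<^sup>1\<close>-Cauchy sequences, which have almost everywhere convergent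
  subsequences.
\<close>

lemma L1_norm_le_L2_norm:
  assumes "\<Omega> \<in> lmeasurable" "f \<in> L2 \<Omega>"
  shows "integrable (lebesgue_on \<Omega>) (\<lambda>x. norm (f x))"
    and "(LINT x|lebesgue_on \<Omega>. norm (f x)) \<le> L2_norm \<Omega> f * L2_norm \<Omega> (\<lambda>x. 1::real)"
proof -
  have n: "(\<lambda>x. norm (f x)) \<in> L2 \<Omega>"
    using assms(2) by (auto simp: L2_def intro: borel_measurable_norm)
  have c: "(\<lambda>x. 1::real) \<in> L2 \<Omega>" using const_in_L2[OF assms(1)] .
  show "integrable (lebesgue_on \<Omega>) (\<lambda>x. norm (f x))"
    using integrable_inner_L2[OF n c] by simp
  show "(LINT x|lebesgue_on \<Omega>. norm (f x)) \<le> L2_norm \<Omega> f * L2_norm \<Omega> (\<lambda>x. 1::real)"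
    using L2_Cauchy_Schwarz[OF n c] by (simp add: L2_inner_def L2_norm_def)
qed

text \<open>
  The Riesz-Fischer theorem. The sequence is also Cauchy in \<open>L\<^sup>1\<close>, so a subsequence converges
  almost everywhere. Fatou's lemma bounds the \<open>L\<^sup>2\<close>-distance of the pointwise limit to the members
  of the sequence.
\<close>

lemma L2_complete:
  fixes f :: "nat \<Rightarrow> 'a::euclidean_space \<Rightarrow> 'b::euclidean_space"
  assumes \<Omega>: "\<Omega> \<in> lmeasurable" and f: "\<And>k. f k \<in> L2 \<Omega>"
    and Cauchy: "\<And>e. e > 0 \<Longrightarrow> \<exists>N. \<forall>i\<ge>N. \<forall>j\<ge>N. L2_norm \<Omega> (\<lambda>x. f i x - f j x) < e"
  obtains g where "g \<in> L2 \<Omega>" "(\<lambda>k. L2_norm \<Omega> (\<lambda>x. g x - f k x)) \<longlonglongrightarrow> 0"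
proof -
  let ?M = "lebesgue_on \<Omega>"
  have m [measurable]: "f k \<in> borel_measurable ?M" for k
    using f by (rule L2_measurable)
  \<comment> \<open>The tolerances below are divided by \<open>C + 1\<close> because \<open>C = 0\<close> for a null set \<open>\<Omega>\<close>.\<close>
  define C where "C = L2_norm \<Omega> (\<lambda>x::'a. 1::real)"
  have C0: "C \<ge> 0" by (simp add: C_def)
  obtain r where r: "strict_mono r" and AE_Cauchy: "AE x in ?M. Cauchy (\<lambda>i. f (r i) x)"
  proof (rule cauchy_L1_AE_cauchy_subseq[of ?M f])
    show "integrable ?M (f k)" for k
      using L1_norm_le_L2_norm(1)[OF \<Omega> f] m integrable_norm_cancel by blast
    fix e :: real assume e: "e > 0"
    then obtain N where N: "\<forall>i\<ge>N. \<forall>j\<ge>N. L2_norm \<Omega> (\<lambda>x. f i x - f j x) < e / (C + 1)"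
      using Cauchy[of "e / (C + 1)"] C0 by auto
    have "(LINT x|?M. norm (f i x - f j x)) < e" if "i \<ge> N" "j \<ge> N" for i j
    proof -
      have "(LINT x|?M. norm (f i x - f j x)) \<le> L2_norm \<Omega> (\<lambda>x. f i x - f j x) * C"
        using L1_norm_le_L2_norm(2)[OF \<Omega> L2_diff[OF f f]] by (simp add: C_def)
      also have "\<dots> \<le> e / (C + 1) * C"
        using N that C0 by (intro mult_right_mono) (auto intro: less_imp_le)
      also have "\<dots> < e"
        using e C0 by (simp add: field_simps)
      finally show ?thesis .
    qed
    then show "\<exists>N. \<forall>i\<ge>N. \<forall>j\<ge>N. (LINT x|?M. norm (f i x - f j x)) < e" by blast
  qed
  define g where "g = (\<lambda>x. lim (\<lambda>i. f (r i) x))"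
  have g [measurable]: "g \<in> borel_measurable ?M"
    unfolding g_def by measurable
  have lim: "AE x in ?M. (\<lambda>i. f (r i) x) \<longlonglongrightarrow> g x"
    using AE_Cauchy by eventually_elim (simp add: g_def Cauchy_convergent_iff convergent_LIMSEQ_iff)
  \<comment> \<open>Fatou along the subsequence; only indices from \<open>k\<close> on matter for the lower limit.\<close>
  have bound: "(\<integral>\<^sup>+x. ennreal ((norm (g x - f k x))\<^sup>2) \<partial>?M) \<le> ennreal (e\<^sup>2)"
    if k: "\<forall>i\<ge>k. L2_norm \<Omega> (\<lambda>x. f i x - f k x) < e" for k e
  proof -
    have "(\<integral>\<^sup>+x. ennreal ((norm (g x - f k x))\<^sup>2) \<partial>?M)
        = (\<integral>\<^sup>+x. liminf (\<lambda>i. ennreal ((norm (f (r i) x - f k x))\<^sup>2)) \<partial>?M)"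
    proof (rule nn_integral_cong_AE)
      show "AE x in ?M. ennreal ((norm (g x - f k x))\<^sup>2)
          = liminf (\<lambda>i. ennreal ((norm (f (r i) x - f k x))\<^sup>2))"
        using lim
      proof eventually_elim
        case (elim x)
        have "(\<lambda>i. ennreal ((norm (f (r i) x - f k x))\<^sup>2)) \<longlonglongrightarrow> ennreal ((norm (g x - f k x))\<^sup>2)"
          by (intro tendsto_ennrealI tendsto_intros elim)
        then show ?case using lim_imp_Liminf[of sequentially] by force
      qed
    qed
    also have "\<dots> \<le> liminf (\<lambda>i. \<integral>\<^sup>+x. ennreal ((norm (f (r i) x - f k x))\<^sup>2) \<partial>?M)"
      by (rule nn_integral_liminf) measurable
    also have "\<dots> \<le> liminf (\<lambda>i. ennreal (e\<^sup>2))"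
    proof (rule Liminf_mono)
      have "(\<integral>\<^sup>+x. ennreal ((norm (f (r i) x - f k x))\<^sup>2) \<partial>?M) \<le> ennreal (e\<^sup>2)" if "i \<ge> k" for i
      proof -
        have ri: "r i \<ge> k" using seq_suble[OF r, of i] that by simp
        have "(\<integral>\<^sup>+x. ennreal ((norm (f (r i) x - f k x))\<^sup>2) \<partial>?M)
            = ennreal (LINT x|?M. (norm (f (r i) x - f k x))\<^sup>2)"
          using L2_diff[OF f f] by (intro nn_integral_eq_integral) (auto simp: L2_def)
        also have "\<dots> = ennreal ((L2_norm \<Omega> (\<lambda>x. f (r i) x - f k x))\<^sup>2)"
          by (simp add: L2_norm_def)
        also have "\<dots> \<le> ennreal (e\<^sup>2)"
          using k ri by (intro ennreal_leI power_mono) (auto intro: less_imp_le)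
        finally show ?thesis .
      qed
      then show "\<forall>\<^sub>F i in sequentially.
          (\<integral>\<^sup>+x. ennreal ((norm (f (r i) x - f k x))\<^sup>2) \<partial>?M) \<le> ennreal (e\<^sup>2)"
        by (auto simp: eventually_sequentially)
    qed
    also have "\<dots> = ennreal (e\<^sup>2)" by (simp add: Liminf_const)
    finally show ?thesis .
  qed
  have close: "(\<lambda>x. g x - f k x) \<in> L2 \<Omega> \<and> L2_norm \<Omega> (\<lambda>x. g x - f k x) \<le> e"
    if k: "\<forall>i\<ge>k. L2_norm \<Omega> (\<lambda>x. f i x - f k x) < e" for k e
  proof -
    have e: "e \<ge> 0"
      using k[rule_format, of k] L2_norm_nonneg[of \<Omega> "\<lambda>x. f k x - f k x"] by linarith
    have int: "integrable ?M (\<lambda>x. (norm (g x - f k x))\<^sup>2)"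
      using bound[OF k] by (intro integrableI_bounded) (auto simp: le_less_trans)
    have "ennreal (LINT x|?M. (norm (g x - f k x))\<^sup>2) \<le> ennreal (e\<^sup>2)"
      using bound[OF k] by (subst (asm) nn_integral_eq_integral[OF int]) auto
    then have "(LINT x|?M. (norm (g x - f k x))\<^sup>2) \<le> e\<^sup>2"
      by (subst (asm) ennreal_le_iff) auto
    then show ?thesis
      using int e by (auto simp: L2_def L2_norm_def intro: real_le_lsqrt)
  qed
  have ev: "\<exists>N. \<forall>k\<ge>N. (\<lambda>x. g x - f k x) \<in> L2 \<Omega> \<and> L2_norm \<Omega> (\<lambda>x. g x - f k x) \<le> e"
    if "e > 0" for e
    using Cauchy[OF that] close by (meson order_trans)
  obtain N where "(\<lambda>x. g x - f N x) \<in> L2 \<Omega>" using ev[of 1] by auto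
  from L2_add[OF this f[of N]] have "g \<in> L2 \<Omega>" by simp
  moreover have "(\<lambda>k. L2_norm \<Omega> (\<lambda>x. g x - f k x)) \<longlonglongrightarrow> 0"
  proof (rule LIMSEQ_I)
    fix e :: real assume "e > 0"
    then show "\<exists>N. \<forall>k\<ge>N. norm (L2_norm \<Omega> (\<lambda>x. g x - f k x) - 0) < e"
      using ev[of "e / 2"] by fastforce
  qed
  ultimately show ?thesis by (rule that)
qed

section \<open>Smoothness and test functions\<close>

lemma partial_deriv_eqI: "(f has_derivative f') (at x) \<Longrightarrow> partial_deriv i f x = f' (axis i 1)"
  by (metis frechet_derivative_at partial_deriv_def)

lemma C_k_0: "C_k k (\<lambda>x::real^'n. 0::'b::real_normed_vector)"
proof (induction k)
  case (Suc k)
  have "partial_deriv i (\<lambda>x::real^'n. 0::'b) = (\<lambda>x. 0)" for i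
    by (rule ext, subst partial_deriv_eqI[OF has_derivative_const]) simp
  with Suc show ?case by simp
qed simp

lemma C_k_const: "C_k k (\<lambda>x::real^'n. c::'b::real_normed_vector)"
proof (cases k)
  case (Suc l)
  have "partial_deriv i (\<lambda>x::real^'n. c) = (\<lambda>x. 0)" for i
    by (rule ext, subst partial_deriv_eqI[OF has_derivative_const]) simp
  with Suc show ?thesis by (simp add: C_k_0)
qed simp

lemma C_k_bounded_linear:
  assumes "bounded_linear T"
  shows "C_k k f \<Longrightarrow> C_k k (\<lambda>x. T (f x))"
proof (induction k arbitrary: f)
  case 0
  then show ?case
    using bounded_linear.continuous_on[OF assms, of UNIV f] by simp
next
  case (Suc k)
  have D: "((\<lambda>x. T (f x)) has_derivative (\<lambda>h. T (frechet_derivative f (at x) h))) (at x)" for x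
    using Suc.prems by (intro bounded_linear.has_derivative[OF assms])
      (simp add: frechet_derivative_works[symmetric])
  have "partial_deriv i (\<lambda>x. T (f x)) = (\<lambda>x. T (partial_deriv i f x))" for i
    by (rule ext, subst partial_deriv_eqI[OF D]) (simp add: partial_deriv_def)
  then show ?case
    using Suc differentiableI[OF D] by simp
qed

lemma C_k_add: "C_k k f \<Longrightarrow> C_k k g \<Longrightarrow> C_k k (\<lambda>x. f x + g x)"
proof (induction k arbitrary: f g)
  case 0
  then show ?case by (auto intro: continuous_on_add)
next
  case (Suc k)
  have D: "((\<lambda>x. f x + g x) has_derivative
      (\<lambda>h. frechet_derivative f (at x) h + frechet_derivative g (at x) h)) (at x)" for x
    using Suc.prems by (intro has_derivative_add) (simp_all add: frechet_derivative_works[symmetric])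
  have "partial_deriv i (\<lambda>x. f x + g x) = (\<lambda>x. partial_deriv i f x + partial_deriv i g x)" for i
    by (rule ext, subst partial_deriv_eqI[OF D]) (simp add: partial_deriv_def)
  then show ?case
    using Suc differentiableI[OF D] by simp
qed

lemma C_k_Suc_imp: "C_k (Suc k) f \<Longrightarrow> C_k k f"
proof (induction k arbitrary: f)
  case 0
  then show ?case
    by (auto intro!: continuous_at_imp_continuous_on differentiable_imp_continuous_within)
qed auto

text \<open>
  By the product rule, the partial derivatives of a product involve the factors themselves, which are
  \<open>C_k\<close> of one order less by the preceding lemma.
\<close>

lemma C_k_mult:
  fixes f g :: "real ^ 'n \<Rightarrow> real"
  shows "C_k k f \<Longrightarrow> C_k k g \<Longrightarrow> C_k k (\<lambda>x. f x * g x)"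
proof (induction k arbitrary: f g)
  case 0
  then show ?case by (auto intro: continuous_on_mult)
next
  case (Suc k)
  have D: "((\<lambda>x. f x * g x) has_derivative
      (\<lambda>h. f x * frechet_derivative g (at x) h + frechet_derivative f (at x) h * g x)) (at x)" for x
    using Suc.prems by (intro has_derivative_mult) (simp_all add: frechet_derivative_works[symmetric])
  have "partial_deriv i (\<lambda>x. f x * g x) = (\<lambda>x. f x * partial_deriv i g x + partial_deriv i f x * g x)" for i
    by (rule ext, subst partial_deriv_eqI[OF D]) (simp add: partial_deriv_def)
  then show ?case
    using Suc.IH Suc.prems C_k_Suc_imp[OF Suc.prems(1)] C_k_Suc_imp[OF Suc.prems(2)] differentiableI[OF D]
    by (simp add: C_k_add)
qed

lemma C_k_prod:
  fixes f :: "'i \<Rightarrow> real ^ 'n \<Rightarrow> real"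
  shows "finite I \<Longrightarrow> (\<And>i. i \<in> I \<Longrightarrow> C_k k (f i)) \<Longrightarrow> C_k k (\<lambda>x. \<Prod>i\<in>I. f i x)"
  by (induction I rule: finite_induct) (auto intro: C_k_const C_k_mult)

lemma test_functionsI:
  assumes "\<And>k. C_k k \<phi>" "compact K" "K \<subseteq> \<Omega>" "\<And>x. x \<notin> K \<Longrightarrow> \<phi> x = 0"
  shows "\<phi> \<in> test_functions \<Omega>"
proof -
  have "closure {x. \<phi> x \<noteq> 0} \<subseteq> K"
    using assms by (intro closure_minimal) (auto intro: compact_imp_closed)
  moreover from this have "compact (closure {x. \<phi> x \<noteq> 0})"
    using assms(2) by (metis closed_closure compact_Int_closed inf.absorb_iff2)
  ultimately show ?thesis
    using assms(1,3) by (auto simp: test_functions_def)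
qed

text \<open>
  A compact set outside which the function vanishes is easier to work with than the closure of
  the set where it does not vanish.
\<close>

lemma test_functionsE:
  assumes "\<phi> \<in> test_functions \<Omega>"
  obtains K where "compact K" "K \<subseteq> \<Omega>" "\<And>x. x \<notin> K \<Longrightarrow> \<phi> x = 0"
proof (rule that[of "closure {x. \<phi> x \<noteq> 0}"])
  fix x assume "x \<notin> closure {x. \<phi> x \<noteq> 0}"
  then show "\<phi> x = 0" using closure_subset[of "{x. \<phi> x \<noteq> 0}"] by blast
qed (use assms in \<open>auto simp: test_functions_def\<close>)

lemma test_functions_C_k: "\<phi> \<in> test_functions \<Omega> \<Longrightarrow> C_k k \<phi>"
  by (simp add: test_functions_def)

lemma test_functions_continuous: "\<phi> \<in> test_functions \<Omega> \<Longrightarrow> continuous_on UNIV \<phi>"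
  using test_functions_C_k[of \<phi> \<Omega> 0] by simp

lemma test_functions_has_derivative:
  "\<phi> \<in> test_functions \<Omega> \<Longrightarrow> (\<phi> has_derivative frechet_derivative \<phi> (at x)) (at x)"
  using test_functions_C_k[of \<phi> \<Omega> 1] by (simp add: frechet_derivative_works[symmetric])

lemma test_functions_0: "(\<lambda>x. 0) \<in> test_functions \<Omega>"
  by (rule test_functionsI[where K = "{}"]) (auto simp: C_k_0)

lemma test_functions_bounded_linear:
  assumes "bounded_linear T" "\<phi> \<in> test_functions \<Omega>"
  shows "(\<lambda>x. T (\<phi> x)) \<in> test_functions \<Omega>"
proof -
  obtain K where "compact K" "K \<subseteq> \<Omega>" "\<And>x. x \<notin> K \<Longrightarrow> \<phi> x = 0"
    by (rule test_functionsE[OF assms(2)]) blast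
  then show ?thesis
    using assms by (intro test_functionsI[where K = K])
      (auto intro: C_k_bounded_linear test_functions_C_k simp: linear_0 bounded_linear.linear)
qed

lemma test_functions_add:
  assumes "\<phi> \<in> test_functions \<Omega>" "\<psi> \<in> test_functions \<Omega>"
  shows "(\<lambda>x. \<phi> x + \<psi> x) \<in> test_functions \<Omega>"
proof -
  obtain K where "compact K" "K \<subseteq> \<Omega>" "\<And>x. x \<notin> K \<Longrightarrow> \<phi> x = 0"
    by (rule test_functionsE[OF assms(1)]) blast
  moreover obtain L where "compact L" "L \<subseteq> \<Omega>" "\<And>x. x \<notin> L \<Longrightarrow> \<psi> x = 0"
    by (rule test_functionsE[OF assms(2)]) blast
  ultimately show ?thesis
    using assms by (intro test_functionsI[where K = "K \<union> L"])
      (auto intro: C_k_add test_functions_C_k)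
qed

lemma test_functions_scaleR:
  "\<phi> \<in> test_functions \<Omega> \<Longrightarrow> (\<lambda>x. c *\<^sub>R \<phi> x) \<in> test_functions \<Omega>"
  by (rule test_functions_bounded_linear[OF bounded_linear_scaleR_right])

lemma test_functions_diff:
  "\<phi> \<in> test_functions \<Omega> \<Longrightarrow> \<psi> \<in> test_functions \<Omega> \<Longrightarrow> (\<lambda>x. \<phi> x - \<psi> x) \<in> test_functions \<Omega>"
  using test_functions_add[of \<phi> \<Omega> "\<lambda>x. (-1) *\<^sub>R \<psi> x"] test_functions_scaleR[of \<psi> \<Omega> "-1"] by simp

lemma test_functions_sum:
  "finite I \<Longrightarrow> (\<And>i. i \<in> I \<Longrightarrow> \<phi> i \<in> test_functions \<Omega>)
    \<Longrightarrow> (\<lambda>x. \<Sum>i\<in>I. \<phi> i x) \<in> test_functions \<Omega>"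
  by (induction I rule: finite_induct) (auto simp: test_functions_0 intro: test_functions_add)

lemma test_functions_partial_deriv:
  assumes "\<phi> \<in> test_functions \<Omega>"
  shows "partial_deriv i \<phi> \<in> test_functions \<Omega>"
proof -
  obtain K where K: "compact K" "K \<subseteq> \<Omega>" "\<And>x. x \<notin> K \<Longrightarrow> \<phi> x = 0"
    by (rule test_functionsE[OF assms]) blast
  have "partial_deriv i \<phi> x = 0" if "x \<notin> K" for x
  proof -
    have "(\<phi> has_derivative (\<lambda>h. 0)) (at x)"
      using K that
      by (intro has_derivative_transform_within_open[OF has_derivative_const, where s = "- K"])
        (auto simp: compact_imp_closed open_Compl)
    then show ?thesis by (rule partial_deriv_eqI)
  qed
  moreover have "C_k k (partial_deriv i \<phi>)" for k
    using test_functions_C_k[OF assms, of "Suc k"] by simp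
  ultimately show ?thesis using K by (intro test_functionsI[where K = K])
qed

lemma test_functions_bounded:
  assumes "\<phi> \<in> test_functions \<Omega>"
  obtains B where "\<And>x. norm (\<phi> x) \<le> B"
proof -
  obtain K where K: "compact K" "K \<subseteq> \<Omega>" "\<And>x. x \<notin> K \<Longrightarrow> \<phi> x = 0"
    by (rule test_functionsE[OF assms]) blast
  have "bounded (\<phi> ` K)"
    using K(1) test_functions_continuous[OF assms]
    by (intro compact_imp_bounded compact_continuous_image) (auto intro: continuous_on_subset)
  then obtain B where "\<And>x. x \<in> K \<Longrightarrow> norm (\<phi> x) \<le> B" by (auto simp: bounded_iff)
  then have "norm (\<phi> x) \<le> max 0 B" for x
    using K(3)[of x] by (cases "x \<in> K") (auto simp: le_max_iff_disj)
  then show ?thesis by (rule that)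
qed

lemma test_functions_L2:
  assumes "\<Omega> \<in> lmeasurable" "\<phi> \<in> test_functions \<Omega>"
  shows "\<phi> \<in> L2 \<Omega>"
proof -
  obtain B where B: "\<And>x. norm (\<phi> x) \<le> B" by (rule test_functions_bounded[OF assms(2)]) blast
  have m: "\<phi> \<in> borel_measurable (lebesgue_on \<Omega>)"
    using test_functions_continuous[OF assms(2)] assms(1)
    by (intro continuous_imp_measurable_on_sets_lebesgue) (auto intro: continuous_on_subset)
  have "integrable (lebesgue_on \<Omega>) (\<lambda>x. (norm (\<phi> x))\<^sup>2)"
  proof (rule finite_measure.integrable_const_bound[OF finite_measure_lebesgue_on[OF assms(1)]])
    show "AE x in lebesgue_on \<Omega>. norm ((norm (\<phi> x))\<^sup>2) \<le> B\<^sup>2"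
      using B by (intro AE_I2) (simp add: power_mono)
    show "(\<lambda>x. (norm (\<phi> x))\<^sup>2) \<in> borel_measurable (lebesgue_on \<Omega>)"
      using m by measurable
  qed
  with m show ?thesis by (simp add: L2_def)
qed

definition gradient :: "(real ^ 'n \<Rightarrow> real) \<Rightarrow> real ^ 'n \<Rightarrow> real ^ 'n" where
  "gradient u x = (\<chi> i. partial_deriv i u x)"

lemma gradient_test_function:
  assumes "u \<in> test_functions \<Omega>"
  shows "gradient u \<in> test_functions \<Omega>"
proof -
  have "gradient u = (\<lambda>x. \<Sum>i\<in>UNIV. partial_deriv i u x *\<^sub>R axis i 1)"
    by (simp add: fun_eq_iff vec_eq_iff gradient_def axis_def if_distrib cong: if_cong)
  moreover have "(\<lambda>x. partial_deriv i u x *\<^sub>R axis i (1::real)) \<in> test_functions \<Omega>" for i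
    by (intro test_functions_bounded_linear[OF bounded_linear_scaleR_left]
        test_functions_partial_deriv assms)
  ultimately show ?thesis by (simp add: test_functions_sum)
qed

lemma gradient_add_scaleR:
  assumes "u \<in> test_functions \<Omega>" "v \<in> test_functions \<Omega>"
  shows "gradient (\<lambda>x. u x + c *\<^sub>R v x) = (\<lambda>x. gradient u x + c *\<^sub>R gradient v x)"
proof -
  have "((\<lambda>x. u x + c *\<^sub>R v x) has_derivative
      (\<lambda>h. frechet_derivative u (at x) h + c *\<^sub>R frechet_derivative v (at x) h)) (at x)" for x
    using assms by (intro derivative_intros test_functions_has_derivative)
  from partial_deriv_eqI[OF this] show ?thesis
    by (simp add: fun_eq_iff vec_eq_iff gradient_def partial_deriv_def)
qed

lemma gradient_diff:
  assumes "u \<in> test_functions \<Omega>" "v \<in> test_functions \<Omega>"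
  shows "gradient (\<lambda>x. u x - v x) = (\<lambda>x. gradient u x - gradient v x)"
  using gradient_add_scaleR[OF assms, of "-1"] by simp

section \<open>Exchanging partial derivatives under the integral\<close>

text \<open>
  Translations commute with each other and preserve Lebesgue measure, so for difference quotients the
  identity between \<open>\<integral> \<partial>\<^sub>i u \<partial>\<^sub>j v\<close> and \<open>\<integral> \<partial>\<^sub>j u \<partial>\<^sub>i v\<close> holds exactly and involves only first
  differences. It survives the passage to the limit.
\<close>

definition diff_quot :: "real \<Rightarrow> 'n \<Rightarrow> (real ^ 'n \<Rightarrow> real) \<Rightarrow> real ^ 'n \<Rightarrow> real" where
  "diff_quot h i u x = (u (x + h *\<^sub>R axis i 1) - u x) / h"

text \<open>
  In contrast to the test functions on a bounded set, this class is closed under translations, hence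
  under difference quotients.
\<close>

definition cont_compact_support :: "(real ^ 'n \<Rightarrow> real) \<Rightarrow> bool" where
  "cont_compact_support u \<longleftrightarrow> continuous_on UNIV u \<and> (\<exists>R. \<forall>x. norm x > R \<longrightarrow> u x = 0)"

lemma test_functions_cont_compact_support:
  assumes "\<phi> \<in> test_functions \<Omega>"
  shows "cont_compact_support \<phi>"
proof -
  obtain K where K: "compact K" "K \<subseteq> \<Omega>" "\<And>x. x \<notin> K \<Longrightarrow> \<phi> x = 0"
    by (rule test_functionsE[OF assms]) blast
  obtain R where "\<And>x. x \<in> K \<Longrightarrow> norm x \<le> R"
    using compact_imp_bounded[OF K(1)] by (auto simp: bounded_iff)
  then have "\<forall>x. norm x > R \<longrightarrow> \<phi> x = 0" using K(3) by (meson not_less)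
  then show ?thesis
    using test_functions_continuous[OF assms] by (auto simp: cont_compact_support_def)
qed

lemma cont_compact_support_translate:
  assumes "cont_compact_support u"
  shows "cont_compact_support (\<lambda>x. u (x + a))"
proof -
  obtain R where R: "\<And>x. norm x > R \<Longrightarrow> u x = 0" and c: "continuous_on UNIV u"
    using assms by (auto simp: cont_compact_support_def)
  have "u (x + a) = 0" if "norm x > R + norm a" for x
    using that norm_triangle_ineq4[of "x + a" a] by (intro R) simp
  moreover have "continuous_on UNIV (\<lambda>x. u (x + a))"
    by (intro continuous_on_compose2[OF c] continuous_intros) auto
  ultimately show ?thesis by (auto simp: cont_compact_support_def)
qed

lemma cont_compact_support_diff_quot:
  assumes "cont_compact_support u"
  shows "cont_compact_support (diff_quot h i u)"
proof -
  obtain R where R: "\<And>x. norm x > R \<Longrightarrow> u x = 0" and c: "continuous_on UNIV u"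
    using assms by (auto simp: cont_compact_support_def)
  obtain S where S: "\<And>x. norm x > S \<Longrightarrow> u (x + h *\<^sub>R axis i 1) = 0"
    and d: "continuous_on UNIV (\<lambda>x. u (x + h *\<^sub>R axis i 1))"
    using cont_compact_support_translate[OF assms] by (auto simp: cont_compact_support_def)
  have "continuous_on UNIV (diff_quot h i u)"
    using continuous_on_mult_right[OF continuous_on_diff[OF d c], of "1 / h"]
    by (simp add: diff_quot_def[abs_def])
  then show ?thesis
    unfolding cont_compact_support_def
    by (intro conjI exI[of _ "max R S"]) (auto simp: R S diff_quot_def)
qed

lemma cont_compact_support_integrable_mult:
  assumes "cont_compact_support u" "cont_compact_support v"
  shows "integrable lborel (\<lambda>x. u x * v x)"
proof -
  obtain R where R: "\<And>x. norm x > R \<Longrightarrow> u x = 0" and c: "continuous_on UNIV u"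
    using assms by (auto simp: cont_compact_support_def)
  have d: "continuous_on UNIV v" using assms by (auto simp: cont_compact_support_def)
  have "set_integrable lborel (cball 0 R) (\<lambda>x. u x * v x)"
    unfolding set_integrable_def
    using c d by (intro borel_integrable_compact continuous_on_mult) (auto intro: continuous_on_subset)
  moreover have "indicator (cball 0 R) x *\<^sub>R (u x * v x) = u x * v x" for x
    using R[of x] by (auto simp: indicator_def)
  ultimately show ?thesis by (simp only: set_integrable_def)
qed

lemma lborel_integral_translate:
  fixes f :: "'a::euclidean_space \<Rightarrow> real"
  assumes "f \<in> borel_measurable borel"
  shows "(LINT x|lborel. f (x + a)) = (LINT x|lborel. f x)"
proof -
  have "(LINT x|lborel. f x) = (LINT x|distr lborel borel ((+) a). f x)"
    by (simp add: lborel_distr_plus)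
  also have "\<dots> = (LINT x|lborel. f (a + x))"
    using assms by (intro integral_distr) auto
  finally show ?thesis by (simp add: add.commute)
qed

text \<open>
  Summation by parts: the translation by \<open>h\<close> in the first factor becomes the translation by
  \<open>- h\<close> in the second one.
\<close>

lemma diff_quot_by_parts:
  assumes "cont_compact_support u" "cont_compact_support v"
  shows "(LINT x|lborel. diff_quot h i u x * v x) = - (LINT x|lborel. u x * diff_quot (- h) i v x)"
proof (cases "h = 0")
  case False
  let ?a = "h *\<^sub>R axis i 1"
  note tr = cont_compact_support_translate
  have m: "(\<lambda>x. u (x + ?a) * v x) \<in> borel_measurable borel"
    using tr[OF assms(1), of ?a] assms(2)
    by (intro borel_measurable_continuous_onI continuous_on_mult) (auto simp: cont_compact_support_def)
  have "(LINT x|lborel. diff_quot h i u x * v x)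
      = (LINT x|lborel. (u (x + ?a) * v x - u x * v x) / h)"
    by (simp add: diff_quot_def algebra_simps diff_divide_distrib)
  also have "\<dots> = ((LINT x|lborel. u (x + ?a) * v x) - (LINT x|lborel. u x * v x)) / h"
    using assms by (simp add: cont_compact_support_integrable_mult tr)
  also have "(LINT x|lborel. u (x + ?a) * v x) = (LINT x|lborel. u x * v (x + (- ?a)))"
    using lborel_integral_translate[OF m, of "- ?a"] by simp
  also have "((LINT x|lborel. u x * v (x + (- ?a))) - (LINT x|lborel. u x * v x)) / h
      = (LINT x|lborel. (u x * v (x + (- ?a)) - u x * v x) / h)"
    using assms tr[OF assms(2), of "- ?a"]
    by (subst integral_divide_zero, subst Bochner_Integration.integral_diff)
      (auto intro!: cont_compact_support_integrable_mult)
  also have "\<dots> = (LINT x|lborel. - (u x * diff_quot (- h) i v x))"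
    using False by (intro Bochner_Integration.integral_cong) (auto simp: diff_quot_def field_simps)
  finally show ?thesis by simp
qed (simp add: diff_quot_def)

lemma diff_quot_commute: "diff_quot h i (diff_quot k j u) = diff_quot k j (diff_quot h i u)"
  by (simp add: fun_eq_iff diff_quot_def diff_divide_distrib add_ac mult_ac)

text \<open>
  Moving the first quotient to \<open>v\<close>, commuting the two quotients there and moving the second one
  to \<open>u\<close> exchanges the directions. Each move changes the sign and the step to its negative.
\<close>

lemma diff_quot_swap:
  assumes "cont_compact_support u" "cont_compact_support v"
  shows "(LINT x|lborel. diff_quot h i u x * diff_quot k j v x)
    = (LINT x|lborel. diff_quot (- k) j u x * diff_quot (- h) i v x)"
  using diff_quot_by_parts[OF assms(1) cont_compact_support_diff_quot[OF assms(2)], of h i k j]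
    diff_quot_by_parts[OF assms(1) cont_compact_support_diff_quot[OF assms(2)], of "- k" j "- h" i]
  by (simp add: diff_quot_commute)

lemma test_function_line_derivative:
  fixes u :: "real ^ 'n \<Rightarrow> real"
  assumes "u \<in> test_functions \<Omega>"
  shows "((\<lambda>t. u (x + t *\<^sub>R axis i 1)) has_real_derivative
    partial_deriv i u (x + t *\<^sub>R axis i 1)) (at t)"
proof -
  let ?y = "x + t *\<^sub>R axis i 1"
  have lin: "linear (frechet_derivative u (at ?y))"
    using test_functions_has_derivative[OF assms] by (rule has_derivative_linear)
  have "((\<lambda>t. x + t *\<^sub>R axis i 1) has_derivative (\<lambda>s. s *\<^sub>R axis i 1)) (at t)"
    by (auto intro!: derivative_eq_intros)
  from has_derivative_compose[OF this test_functions_has_derivative[OF assms]]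
  have "((\<lambda>t. u (x + t *\<^sub>R axis i 1)) has_derivative
      (\<lambda>s. frechet_derivative u (at ?y) (s *\<^sub>R axis i 1))) (at t)" .
  moreover have "frechet_derivative u (at ?y) (s *\<^sub>R axis i 1) = partial_deriv i u ?y * s" for s
    by (simp add: linear_scale[OF lin] partial_deriv_def mult.commute)
  ultimately show ?thesis
    by (simp add: has_field_derivative_def)
qed

text \<open>
  The mean value inequality along a coordinate line supplies the majorant for dominated
  convergence.
\<close>

lemma abs_diff_quot_le:
  assumes "u \<in> test_functions \<Omega>" "\<And>x. \<bar>partial_deriv i u x\<bar> \<le> B"
  shows "\<bar>diff_quot h i u x\<bar> \<le> B"
proof (cases "h = 0")
  case True
  then show ?thesis using assms(2)[of x] by (simp add: diff_quot_def)
next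
  case False
  have "norm (u (x + h *\<^sub>R axis i 1) - u (x + 0 *\<^sub>R axis i 1)) \<le> B * norm (h - 0)"
  proof (rule field_differentiable_bound[of UNIV])
    show "((\<lambda>t. u (x + t *\<^sub>R axis i 1)) has_field_derivative
        partial_deriv i u (x + t *\<^sub>R axis i 1)) (at t within UNIV)" for t
      using test_function_line_derivative[OF assms(1)] .
  qed (simp_all add: assms(2))
  then show ?thesis using False by (simp add: diff_quot_def field_simps abs_divide)
qed

lemma diff_quot_tendsto:
  assumes "u \<in> test_functions \<Omega>" "h \<longlonglongrightarrow> 0" "\<And>k. h k \<noteq> 0"
  shows "(\<lambda>k. diff_quot (h k) i u x) \<longlonglongrightarrow> partial_deriv i u x"
proof -
  have "((\<lambda>t. diff_quot t i u x) \<longlongrightarrow> partial_deriv i u x) (at 0)"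
    using test_function_line_derivative[OF assms(1), of x i 0]
    by (simp add: has_field_derivative_iff diff_quot_def)
  then show ?thesis
    by (rule filterlim_compose) (auto simp: filterlim_at assms)
qed

lemma diff_quot_integral_tendsto:
  assumes u: "u \<in> test_functions \<Omega>" and v: "v \<in> test_functions \<Omega>"
    and h: "h \<longlonglongrightarrow> 0" "\<And>k. h k \<noteq> 0" "\<And>k. \<bar>h k\<bar> \<le> 1"
  shows "(\<lambda>k. LINT x|lborel. diff_quot (h k) i u x * diff_quot (h k) j v x)
    \<longlonglongrightarrow> (LINT x|lborel. partial_deriv i u x * partial_deriv j v x)"
proof -
  obtain A where A: "\<And>x. \<bar>partial_deriv i u x\<bar> \<le> A"
    using test_functions_bounded[OF test_functions_partial_deriv[OF u, of i]] by auto
  obtain B where B: "\<And>x. \<bar>partial_deriv j v x\<bar> \<le> B"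
    using test_functions_bounded[OF test_functions_partial_deriv[OF v, of j]] by auto
  note cs = test_functions_cont_compact_support
  obtain R where R: "\<And>x. norm x > R \<Longrightarrow> u x = 0"
    using cs[OF u] by (auto simp: cont_compact_support_def)
  have supp: "diff_quot (h k) i u x = 0" if "x \<notin> cball 0 (R + 1)" for k x
  proof -
    have "norm x \<le> norm (x + h k *\<^sub>R axis i 1) + norm (h k *\<^sub>R axis i (1::real))"
      using norm_triangle_ineq4[of "x + h k *\<^sub>R axis i 1" "h k *\<^sub>R axis i 1"] by simp
    then have "norm (x + h k *\<^sub>R axis i 1) > R" "norm x > R"
      using that h(3)[of k] by auto
    then show ?thesis by (simp add: diff_quot_def R)
  qed
  show ?thesis
  proof (rule integral_dominated_convergence)
    show "integrable lborel (\<lambda>x. indicator (cball 0 (R + 1)) x * (A * B))"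
      using emeasure_bounded_finite[OF bounded_cball]
      by (intro integrable_mult_left integrable_real_indicator) auto
    show "(\<lambda>x. partial_deriv i u x * partial_deriv j v x) \<in> borel_measurable lborel"
      using test_functions_continuous[OF test_functions_partial_deriv[OF u, of i]]
        test_functions_continuous[OF test_functions_partial_deriv[OF v, of j]]
      by (auto intro!: borel_measurable_continuous_onI continuous_on_mult)
    show "(\<lambda>x. diff_quot (h k) i u x * diff_quot (h k) j v x) \<in> borel_measurable lborel" for k
      using cs[OF u, THEN cont_compact_support_diff_quot, of "h k" i]
        cs[OF v, THEN cont_compact_support_diff_quot, of "h k" j]
      by (auto simp: cont_compact_support_def intro!: borel_measurable_continuous_onI continuous_on_mult)
    show "AE x in lborel. (\<lambda>k. diff_quot (h k) i u x * diff_quot (h k) j v x)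
        \<longlonglongrightarrow> partial_deriv i u x * partial_deriv j v x"
      using u v h by (intro AE_I2 tendsto_mult diff_quot_tendsto)
    show "AE x in lborel. norm (diff_quot (h k) i u x * diff_quot (h k) j v x)
        \<le> indicator (cball 0 (R + 1)) x * (A * B)" for k
      using abs_diff_quot_le[OF u A, of "h k"] abs_diff_quot_le[OF v B, of "h k"] supp[of _ k]
      by (intro AE_I2) (auto simp: indicator_def abs_mult
          intro!: mult_mono order_trans[OF abs_ge_zero abs_diff_quot_le[OF u A]])
  qed
qed

lemma integral_lebesgue_on_eq_lborel:
  fixes f :: "'a::euclidean_space \<Rightarrow> real"
  assumes "\<Omega> \<in> sets lebesgue" "f \<in> borel_measurable borel" "\<And>x. x \<notin> \<Omega> \<Longrightarrow> f x = 0"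
  shows "(LINT x|lebesgue_on \<Omega>. f x) = (LINT x|lborel. f x)"
proof -
  have "(\<lambda>x. indicator \<Omega> x *\<^sub>R f x) = f"
    using assms(3) by (auto simp: fun_eq_iff indicator_def)
  then show ?thesis
    using assms(1,2) by (simp add: integral_restrict_space integral_completion)
qed

text \<open>
  The discrete identity \<open>diff_quot_swap\<close> passes to the limit with the steps \<open>1 / (k + 1)\<close> on the left and
  their negatives on the right. For \<open>i \<noteq> j\<close> it says that gradients are curl free; as a
  statement about the entries of the Jacobian matrix of a test field it is the source of Korn's
  inequality.
\<close>

lemma test_function_gradient_swap:
  fixes u v :: "real ^ 'n \<Rightarrow> real"
  assumes \<Omega>: "\<Omega> \<in> sets lebesgue" and u: "u \<in> test_functions \<Omega>" and v: "v \<in> test_functions \<Omega>"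
  shows "(LINT x|lebesgue_on \<Omega>. partial_deriv i u x * partial_deriv j v x)
    = (LINT x|lebesgue_on \<Omega>. partial_deriv j u x * partial_deriv i v x)"
proof -
  have red: "(LINT x|lebesgue_on \<Omega>. partial_deriv i u x * partial_deriv j v x)
      = (LINT x|lborel. partial_deriv i u x * partial_deriv j v x)" for i j
  proof (rule integral_lebesgue_on_eq_lborel[OF \<Omega>])
    show "(\<lambda>x. partial_deriv i u x * partial_deriv j v x) \<in> borel_measurable borel"
      using test_functions_continuous[OF test_functions_partial_deriv[OF u, of i]]
        test_functions_continuous[OF test_functions_partial_deriv[OF v, of j]]
      by (intro borel_measurable_continuous_onI continuous_on_mult)
    show "partial_deriv i u x * partial_deriv j v x = 0" if "x \<notin> \<Omega>" for x
    proof -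
      obtain K where "K \<subseteq> \<Omega>" "\<And>x. x \<notin> K \<Longrightarrow> partial_deriv i u x = 0"
        by (rule test_functionsE[OF test_functions_partial_deriv[OF u, of i]]) blast
      with that show ?thesis by auto
    qed
  qed
  define h :: "nat \<Rightarrow> real" where "h = (\<lambda>k. inverse (real (Suc k)))"
  have h: "h \<longlonglongrightarrow> 0" "\<And>k. h k \<noteq> 0" "\<And>k. \<bar>h k\<bar> \<le> 1"
    using LIMSEQ_inverse_real_of_nat by (auto simp: h_def inverse_le_1_iff)
  have h': "(\<lambda>k. - h k) \<longlonglongrightarrow> 0" "\<And>k. - h k \<noteq> 0" "\<And>k. \<bar>- h k\<bar> \<le> 1"
    using h tendsto_minus[OF h(1)] by auto
  have "(\<lambda>k. LINT x|lborel. diff_quot (h k) i u x * diff_quot (h k) j v x)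
      \<longlonglongrightarrow> (LINT x|lborel. partial_deriv j u x * partial_deriv i v x)"
    using diff_quot_integral_tendsto[OF u v h', of j i] u v
    by (subst diff_quot_swap) (auto intro: test_functions_cont_compact_support)
  with diff_quot_integral_tendsto[OF u v h, of i j]
  have "(LINT x|lborel. partial_deriv i u x * partial_deriv j v x)
      = (LINT x|lborel. partial_deriv j u x * partial_deriv i v x)"
    by (rule LIMSEQ_unique)
  then show ?thesis by (simp only: red)
qed

section \<open>The Helmholtz decomposition\<close>

text \<open>
  The \<open>L\<^sup>2\<close>-closure of the gradients of test functions. On bounded \<open>\<Omega>\<close> these are the gradients of
  the functions in the Sobolev space \<open>H\<^sub>0\<^sup>1(\<Omega>)\<close>, by the Poincare inequality.
\<close>

definition L2_gradients :: "(real ^ 'n) set \<Rightarrow> (real ^ 'n \<Rightarrow> real ^ 'n) set" where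
  "L2_gradients \<Omega> =
     {g \<in> L2 \<Omega>. \<forall>\<epsilon>>0. \<exists>u\<in>test_functions \<Omega>. L2_norm \<Omega> (\<lambda>x. g x - gradient u x) < \<epsilon>}"

lemma gradient_L2: "\<Omega> \<in> lmeasurable \<Longrightarrow> u \<in> test_functions \<Omega> \<Longrightarrow> gradient u \<in> L2 \<Omega>"
  by (intro test_functions_L2 gradient_test_function)

lemma L2_gradients_L2: "g \<in> L2_gradients \<Omega> \<Longrightarrow> g \<in> L2 \<Omega>"
  by (simp add: L2_gradients_def)

lemma L2_gradients_diff:
  assumes \<Omega>: "\<Omega> \<in> lmeasurable" and g: "g \<in> L2_gradients \<Omega>" and u: "u \<in> test_functions \<Omega>"
  shows "(\<lambda>x. g x - gradient u x) \<in> L2_gradients \<Omega>"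
proof -
  have "\<exists>v\<in>test_functions \<Omega>. L2_norm \<Omega> (\<lambda>x. g x - gradient u x - gradient v x) < \<epsilon>"
    if e: "\<epsilon> > 0" for \<epsilon>
  proof -
    obtain w where w: "w \<in> test_functions \<Omega>" "L2_norm \<Omega> (\<lambda>x. g x - gradient w x) < \<epsilon>"
      using g e unfolding L2_gradients_def by blast
    then show ?thesis
      using u by (intro bexI[of _ "\<lambda>x. w x - u x"]) (simp_all add: gradient_diff test_functions_diff)
  qed
  then show ?thesis
    using L2_diff[OF L2_gradients_L2[OF g] gradient_L2[OF \<Omega> u]] by (simp add: L2_gradients_def)
qed

text \<open>
  The inner product with a fixed field is continuous, so orthogonality to the gradients of test
  functions extends to their closure.
\<close>

lemma L2_gradients_inner_eq_0:
  assumes \<Omega>: "\<Omega> \<in> lmeasurable" and f: "f \<in> L2 \<Omega>" and g: "g \<in> L2_gradients \<Omega>"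
    and orth: "\<And>u. u \<in> test_functions \<Omega> \<Longrightarrow> L2_inner \<Omega> (gradient u) f = 0"
  shows "L2_inner \<Omega> g f = 0"
proof (rule ccontr)
  let ?a = "\<bar>L2_inner \<Omega> g f\<bar>" and ?n = "L2_norm \<Omega> f"
  assume "L2_inner \<Omega> g f \<noteq> 0"
  then have a: "?a > 0" by simp
  have n: "?n \<ge> 0" by simp
  have shrink: "b / (c + 1) * c < b" if "b > 0" "c \<ge> 0" for b c :: real
    using that by (simp add: field_simps)
  have "?a / (?n + 1) > 0" using a n by (intro divide_pos_pos) linarith+
  then obtain u where u: "u \<in> test_functions \<Omega>"
    and close: "L2_norm \<Omega> (\<lambda>x. g x - gradient u x) < ?a / (?n + 1)"
    using g unfolding L2_gradients_def by blast
  have gu: "g \<in> L2 \<Omega>" "gradient u \<in> L2 \<Omega>"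
    using g u \<Omega> by (auto intro: L2_gradients_L2 gradient_L2)
  have "?a = \<bar>L2_inner \<Omega> (\<lambda>x. g x - gradient u x) f\<bar>"
    using orth[OF u] by (simp add: L2_inner_diff_left gu f)
  also have "\<dots> \<le> L2_norm \<Omega> (\<lambda>x. g x - gradient u x) * ?n"
    by (intro L2_Cauchy_Schwarz L2_diff gu f)
  also have "\<dots> \<le> ?a / (?n + 1) * ?n"
    using close by (intro mult_right_mono) auto
  also have "\<dots> < ?a"
    using a n by (rule shrink)
  finally show False by simp
qed

text \<open>
  The direct method: by the parallelogram identity, a sequence of gradients that minimizes the distance to \<open>p\<close>
  is Cauchy, and its limit \<open>g\<close> satisfies the first-order condition of the minimization
  problem, which is the orthogonality of \<open>p - g\<close> to all gradients.
\<close>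

lemma L2_gradient_projection:
  assumes \<Omega>: "\<Omega> \<in> lmeasurable" and p: "p \<in> L2 \<Omega>"
  obtains g where "g \<in> L2_gradients \<Omega>"
    "\<And>w. w \<in> test_functions \<Omega> \<Longrightarrow> L2_inner \<Omega> (\<lambda>x. p x - g x) (gradient w) = 0"
proof -
  define T where "T = (test_functions \<Omega> :: (real ^ 'a \<Rightarrow> real) set)"
  define E where "E = (\<lambda>u. (L2_norm \<Omega> (\<lambda>x. p x - gradient u x))\<^sup>2)"
  define D where "D = (INF u\<in>T. E u)"
  have T0: "T \<noteq> {}" using test_functions_0 by (auto simp: T_def)
  have bdd: "bdd_below (E ` T)"
    by (rule bdd_belowI2[of _ 0]) (simp add: E_def)
  have D_le: "D \<le> E u" if "u \<in> T" for u
    unfolding D_def using bdd that by (rule cINF_lower)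
  have "\<exists>u\<in>T. E u < D + inverse (real (Suc k))" for k
    using cINF_less_iff[OF T0 bdd, of "D + inverse (real (Suc k))"] by (simp add: D_def)
  then obtain u where uT: "\<And>k. u k \<in> T" and u: "\<And>k. E (u k) < D + inverse (real (Suc k))"
    by metis
  have grad: "gradient v \<in> L2 \<Omega>" if "v \<in> T" for v
    using that \<Omega> by (simp add: T_def gradient_L2)
  have res: "(\<lambda>x. p x - gradient v x) \<in> L2 \<Omega>" if "v \<in> T" for v
    using p grad[OF that] by (rule L2_diff)
  have diff_T: "(\<lambda>x. v x - w x) \<in> T" if "v \<in> T" "w \<in> T" for v w
    using that by (simp add: T_def test_functions_diff)
  have perturb: "D \<le> E v + 2 * t * L2_inner \<Omega> (\<lambda>x. p x - gradient v x) (gradient w)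
      + t\<^sup>2 * (L2_norm \<Omega> (gradient w))\<^sup>2" if v: "v \<in> T" and w: "w \<in> T" for v w t
  proof -
    have "(\<lambda>x. p x - gradient (\<lambda>x. v x + (- t) *\<^sub>R w x) x)
        = (\<lambda>x. (p x - gradient v x) + t *\<^sub>R gradient w x)"
      using gradient_add_scaleR[of v \<Omega> w "- t"] v w by (simp add: T_def algebra_simps)
    then have "E (\<lambda>x. v x + (- t) *\<^sub>R w x) = E v
        + 2 * t * L2_inner \<Omega> (\<lambda>x. p x - gradient v x) (gradient w)
        + t\<^sup>2 * (L2_norm \<Omega> (gradient w))\<^sup>2"
      unfolding E_def by (simp only: power2_L2_norm_add_scaleR[OF res[OF v] grad[OF w]])
    moreover have "(\<lambda>x. v x + (- t) *\<^sub>R w x) \<in> T"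
      using v w unfolding T_def by (intro test_functions_add test_functions_scaleR)
    ultimately show ?thesis using D_le by fastforce
  qed
  \<comment> \<open>Parallelogram identity: the step \<open>t = 1 / 2\<close> from \<open>u i\<close> in direction \<open>- w\<close> leads to the midpoint
      of \<open>u i\<close> and \<open>u j\<close>, the step \<open>t = 1\<close> to \<open>u j\<close>.\<close>
  have dist: "(L2_norm \<Omega> (\<lambda>x. gradient (u i) x - gradient (u j) x))\<^sup>2
      \<le> 2 * (inverse (real (Suc i)) + inverse (real (Suc j)))" for i j
  proof -
    let ?w = "\<lambda>x. u i x - u j x"
    let ?b = "L2_inner \<Omega> (\<lambda>x. p x - gradient (u i) x) (gradient ?w)"
    have w: "?w \<in> T" using uT by (intro diff_T)
    have gw: "gradient ?w = (\<lambda>x. gradient (u i) x - gradient (u j) x)"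
      using uT unfolding T_def by (intro gradient_diff)
    have "E (u j) = (L2_norm \<Omega> (\<lambda>x. (p x - gradient (u i) x) + 1 *\<^sub>R gradient ?w x))\<^sup>2"
      by (simp add: E_def gw)
    also have "\<dots> = E (u i) + 2 * ?b + (L2_norm \<Omega> (gradient ?w))\<^sup>2"
      by (subst power2_L2_norm_add_scaleR[OF res[OF uT] grad[OF w]]) (simp add: E_def)
    finally show ?thesis
      using perturb[OF uT[of i] w, of "1/2"] u[of i] u[of j]
      by (simp add: gw power2_eq_square)
  qed
  obtain g where g: "g \<in> L2 \<Omega>" and lim: "(\<lambda>k. L2_norm \<Omega> (\<lambda>x. g x - gradient (u k) x)) \<longlonglongrightarrow> 0"
  proof (rule L2_complete[OF \<Omega>, of "\<lambda>k. gradient (u k)"])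
    show "gradient (u k) \<in> L2 \<Omega>" for k using uT by (rule grad)
    fix e :: real assume e: "e > 0"
    then obtain N where N: "inverse (real (Suc N)) < e\<^sup>2 / 4"
      using reals_Archimedean[of "e\<^sup>2 / 4"] by auto
    have "L2_norm \<Omega> (\<lambda>x. gradient (u i) x - gradient (u j) x) < e" if "i \<ge> N" "j \<ge> N" for i j
    proof (rule power2_less_imp_less)
      have "inverse (real (Suc i)) \<le> inverse (real (Suc N))"
        "inverse (real (Suc j)) \<le> inverse (real (Suc N))"
        using that by (auto intro!: le_imp_inverse_le)
      then show "(L2_norm \<Omega> (\<lambda>x. gradient (u i) x - gradient (u j) x))\<^sup>2 < e\<^sup>2"
        using dist[of i j] N by argo
    qed (use e in simp)
    then show "\<exists>N. \<forall>i\<ge>N. \<forall>j\<ge>N. L2_norm \<Omega> (\<lambda>x. gradient (u i) x - gradient (u j) x) < e" by blast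
  qed blast
  have "\<exists>v\<in>test_functions \<Omega>. L2_norm \<Omega> (\<lambda>x. g x - gradient v x) < \<epsilon>" if "\<epsilon> > 0" for \<epsilon>
    using order_tendstoD(2)[OF lim that] uT unfolding T_def
    by (auto simp: eventually_sequentially)
  then have gG: "g \<in> L2_gradients \<Omega>" using g by (simp add: L2_gradients_def)
  have "L2_inner \<Omega> (\<lambda>x. p x - g x) (gradient w) = 0" if w: "w \<in> test_functions \<Omega>" for w
  proof -
    have wT: "w \<in> T" using w by (simp add: T_def)
    let ?s = "L2_inner \<Omega> (\<lambda>x. p x - g x) (gradient w)"
    let ?sk = "\<lambda>k. L2_inner \<Omega> (\<lambda>x. p x - gradient (u k) x) (gradient w)"
    have "(\<lambda>k. ?sk k - ?s) \<longlonglongrightarrow> 0"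
    proof (rule Lim_null_comparison)
      have "?sk k - ?s = L2_inner \<Omega> (\<lambda>x. g x - gradient (u k) x) (gradient w)" for k
        using p g grad uT wT by (simp add: L2_inner_diff_left)
      then show "\<forall>\<^sub>F k in sequentially. norm (?sk k - ?s)
          \<le> L2_norm \<Omega> (\<lambda>x. g x - gradient (u k) x) * L2_norm \<Omega> (gradient w)"
        using L2_Cauchy_Schwarz[OF L2_diff[OF g grad[OF uT]] grad[OF wT]] by simp
      show "(\<lambda>k. L2_norm \<Omega> (\<lambda>x. g x - gradient (u k) x) * L2_norm \<Omega> (gradient w)) \<longlonglongrightarrow> 0"
        using tendsto_mult_left_zero[OF lim] .
    qed
    then have sk: "?sk \<longlonglongrightarrow> ?s" by (rule LIM_zero_cancel)
    have "0 \<le> 0 + 2 * t * ?s + t\<^sup>2 * (L2_norm \<Omega> (gradient w))\<^sup>2" for t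
    proof (rule LIMSEQ_le_const)
      show "(\<lambda>k. inverse (real (Suc k)) + 2 * t * ?sk k + t\<^sup>2 * (L2_norm \<Omega> (gradient w))\<^sup>2)
          \<longlonglongrightarrow> 0 + 2 * t * ?s + t\<^sup>2 * (L2_norm \<Omega> (gradient w))\<^sup>2"
        by (intro tendsto_add tendsto_mult tendsto_const sk LIMSEQ_inverse_real_of_nat)
      have "0 \<le> inverse (real (Suc k)) + 2 * t * ?sk k + t\<^sup>2 * (L2_norm \<Omega> (gradient w))\<^sup>2" for k
        using perturb[OF uT[of k] wT, of t] u[of k] by linarith
      then show "\<exists>N. \<forall>k\<ge>N.
          0 \<le> inverse (real (Suc k)) + 2 * t * ?sk k + t\<^sup>2 * (L2_norm \<Omega> (gradient w))\<^sup>2" by blast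
    qed
    from nonneg_quadratic_imp_discriminant[OF _ this] show ?thesis by simp
  qed
  with gG show ?thesis by (rule that)
qed

lemma has_weak_div_0_if_orthogonal:
  assumes "\<And>w. w \<in> test_functions \<Omega> \<Longrightarrow> L2_inner \<Omega> s (gradient w) = 0"
  shows "has_weak_div \<Omega> s (\<lambda>x. 0)"
  using assms by (simp add: has_weak_div_def L2_inner_def inner_vec_def gradient_def)

section \<open>Limits of gradients are curl free\<close>

text \<open>
  Pairing a field with \<open>skew m n\<close> of a gradient produces the integrand that defines the entry
  \<open>(n, m)\<close> of the weak curl, so that statements about the curl become statements about
  inner products.
\<close>

definition skew :: "'n \<Rightarrow> 'n \<Rightarrow> real ^ 'n \<Rightarrow> real ^ 'n" where
  "skew m n y = y $ n *\<^sub>R axis m 1 - y $ m *\<^sub>R axis n 1"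

lemma inner_skew: "v \<bullet> skew m n y = v $ m * y $ n - v $ n * y $ m"
  by (simp add: skew_def inner_diff_right inner_axis)

lemma linear_skew: "linear (skew m n)"
  by (rule linearI) (simp_all add: skew_def algebra_simps)

lemma L2_skew: "f \<in> L2 \<Omega> \<Longrightarrow> (\<lambda>x. skew m n (f x)) \<in> L2 \<Omega>"
  by (rule L2_linear_image[OF linear_skew])

lemma L2_inner_skew:
  assumes "f \<in> L2 \<Omega>" "g \<in> L2 \<Omega>"
  shows "L2_inner \<Omega> f (\<lambda>x. skew m n (g x))
    = (LINT x|lebesgue_on \<Omega>. f x $ m * g x $ n) - (LINT x|lebesgue_on \<Omega>. f x $ n * g x $ m)"
  using integrable_inner_L2[OF L2_component[OF assms(1), of m] L2_component[OF assms(2), of n]]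
    integrable_inner_L2[OF L2_component[OF assms(1), of n] L2_component[OF assms(2), of m]]
  by (simp add: L2_inner_def inner_skew)

lemma L2_inner_skew_swap:
  "L2_inner \<Omega> g (\<lambda>x. skew m n (f x)) = - L2_inner \<Omega> f (\<lambda>x. skew m n (g x))"
  unfolding L2_inner_def inner_skew
  by (subst integral_minus[symmetric]) (simp add: algebra_simps)

lemma L2_gradients_skew_gradient:
  assumes \<Omega>: "\<Omega> \<in> lmeasurable" and g: "g \<in> L2_gradients \<Omega>" and v: "v \<in> test_functions \<Omega>"
  shows "L2_inner \<Omega> g (\<lambda>x. skew m n (gradient v x)) = 0"
proof (rule L2_gradients_inner_eq_0[OF \<Omega> _ g])
  show "(\<lambda>x. skew m n (gradient v x)) \<in> L2 \<Omega>"
    using gradient_L2[OF \<Omega> v] by (rule L2_skew)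
  fix u :: "real ^ 'a \<Rightarrow> real" assume u: "u \<in> test_functions \<Omega>"
  have "(LINT x|lebesgue_on \<Omega>. gradient u x $ m * gradient v x $ n)
      = (LINT x|lebesgue_on \<Omega>. gradient u x $ n * gradient v x $ m)"
    using test_function_gradient_swap[OF _ u v, of m n] \<Omega> by (simp add: gradient_def fmeasurableD)
  then show "L2_inner \<Omega> (gradient u) (\<lambda>x. skew m n (gradient v x)) = 0"
    using u v \<Omega> by (simp add: L2_inner_skew gradient_L2)
qed

text \<open>
  The pairing with \<open>skew\<close> is antisymmetric. This allows the density argument to be applied to one factor
  at a time: first with a gradient of a test function as the second factor, then with a limit of such
  gradients.
\<close>

lemma L2_gradients_swap:
  assumes \<Omega>: "\<Omega> \<in> lmeasurable" and g: "g \<in> L2_gradients \<Omega>" and h: "h \<in> L2_gradients \<Omega>"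
  shows "(LINT x|lebesgue_on \<Omega>. g x $ m * h x $ n) = (LINT x|lebesgue_on \<Omega>. g x $ n * h x $ m)"
proof -
  note L = L2_gradients_L2[OF g] L2_gradients_L2[OF h]
  have "L2_inner \<Omega> g (\<lambda>x. skew m n (h x)) = 0"
  proof (rule L2_gradients_inner_eq_0[OF \<Omega> _ g])
    show "(\<lambda>x. skew m n (h x)) \<in> L2 \<Omega>" using L(2) by (rule L2_skew)
    show "L2_inner \<Omega> (gradient u) (\<lambda>x. skew m n (h x)) = 0" if "u \<in> test_functions \<Omega>" for u
      using L2_gradients_skew_gradient[OF \<Omega> h that] by (subst L2_inner_skew_swap) simp
  qed
  then show ?thesis by (simp add: L2_inner_skew L)
qed

text \<open>
  The equality of the two predicates, rather than of the curls almost everywhere, makes the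
  representatives chosen by \<open>weak_curl\<close> for \<open>v - g\<close> and for \<open>v\<close> identical.
\<close>

lemma has_weak_curl_diff_gradient:
  fixes v :: "'n::{finite,linorder} point \<Rightarrow> 'n point"
  assumes \<Omega>: "\<Omega> \<in> lmeasurable" and v: "v \<in> L2 \<Omega>" and g: "g \<in> L2_gradients \<Omega>"
  shows "has_weak_curl \<Omega> (\<lambda>x. v x - g x) = has_weak_curl \<Omega> v"
proof -
  have rw: "(LINT x|lebesgue_on \<Omega>. f x $ m * partial_deriv n \<phi> x - f x $ n * partial_deriv m \<phi> x)
      = L2_inner \<Omega> f (\<lambda>x. skew m n (gradient \<phi> x))" for f m n \<phi>
    by (simp add: L2_inner_def inner_skew gradient_def)
  have "L2_inner \<Omega> (\<lambda>x. v x - g x) (\<lambda>x. skew m n (gradient \<phi> x))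
      = L2_inner \<Omega> v (\<lambda>x. skew m n (gradient \<phi> x))" if "\<phi> \<in> test_functions \<Omega>" for m n \<phi>
    using L2_gradients_skew_gradient[OF \<Omega> g that, of m n] v L2_gradients_L2[OF g]
      L2_skew[OF gradient_L2[OF \<Omega> that]]
    by (simp add: L2_inner_diff_left)
  then show ?thesis
    unfolding has_weak_curl_def fun_eq_iff rw by simp
qed

lemma weak_curl_diff_gradient:
  assumes "\<Omega> \<in> lmeasurable" "v \<in> L2 \<Omega>" "g \<in> L2_gradients \<Omega>"
  shows "weak_curl \<Omega> (\<lambda>x. v x - g x) = weak_curl \<Omega> v"
  by (simp add: weak_curl_def has_weak_curl_diff_gradient[OF assms])

text \<open>
  If test fields \<open>\<phi>\<close> approximate \<open>p\<close> in the graph norm and gradients \<open>\<nabla>u\<close> of test functions approximate \<open>g\<close> in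
  \<open>L\<^sup>2\<close>, then the test fields \<open>\<phi> - \<nabla>u\<close> approximate \<open>p - g\<close> in the graph norm, because the error
  \<open>g - \<nabla>u\<close> does not contribute to the curl.
\<close>

lemma H0_curl_diff_gradient:
  assumes \<Omega>: "\<Omega> \<in> lmeasurable" and p: "p \<in> H0_curl \<Omega>" and g: "g \<in> L2_gradients \<Omega>"
  shows "(\<lambda>x. p x - g x) \<in> H0_curl \<Omega>"
proof -
  have pL: "p \<in> L2 \<Omega>" and pH: "p \<in> H_curl \<Omega>" using p by (auto simp: H0_curl_def H_curl_def)
  note gL = L2_gradients_L2[OF g]
  have "(\<lambda>x. p x - g x) \<in> H_curl \<Omega>"
    using pH L2_diff[OF pL gL] by (simp add: H_curl_def has_weak_curl_diff_gradient[OF \<Omega> pL g])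
  moreover have "\<exists>\<phi>\<in>test_functions \<Omega>. curl_graph_norm \<Omega> (\<lambda>x. p x - g x - \<phi> x) < \<epsilon>"
    if e: "\<epsilon> > 0" for \<epsilon>
  proof -
    have e2: "\<epsilon> / 2 > 0" using e by simp
    obtain \<phi> where \<phi>: "\<phi> \<in> test_functions \<Omega>" and p\<phi>: "curl_graph_norm \<Omega> (\<lambda>x. p x - \<phi> x) < \<epsilon> / 2"
      using p e2 unfolding H0_curl_def by blast
    obtain u where u: "u \<in> test_functions \<Omega>" and gu: "L2_norm \<Omega> (\<lambda>x. g x - gradient u x) < \<epsilon> / 2"
      using g e2 unfolding L2_gradients_def by blast
    let ?a = "\<lambda>x. p x - \<phi> x" and ?h = "\<lambda>x. g x - gradient u x"
    have a: "?a \<in> L2 \<Omega>" using L2_diff[OF pL test_functions_L2[OF \<Omega> \<phi>]] .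
    have h: "?h \<in> L2_gradients \<Omega>" using \<Omega> g u by (rule L2_gradients_diff)
    have "L2_norm \<Omega> (\<lambda>x. ?a x - ?h x) \<le> L2_norm \<Omega> ?a + L2_norm \<Omega> ?h"
      using a L2_gradients_L2[OF h] by (rule L2_triangle_diff)
    also have "\<dots> \<le> L2_norm \<Omega> ?a + \<epsilon> / 2" using gu by simp
    finally have tri: "L2_norm \<Omega> (\<lambda>x. ?a x - ?h x) \<le> L2_norm \<Omega> ?a + \<epsilon> / 2" .
    have "curl_graph_norm \<Omega> (\<lambda>x. ?a x - ?h x)
        \<le> sqrt ((L2_norm \<Omega> ?a + \<epsilon> / 2)\<^sup>2 + (L2_norm \<Omega> (weak_curl \<Omega> ?a) + 0)\<^sup>2)"
      unfolding curl_graph_norm_def weak_curl_diff_gradient[OF \<Omega> a h]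
      using power_mono[OF tri, of 2] by simp
    also have "\<dots> \<le> curl_graph_norm \<Omega> ?a + sqrt ((\<epsilon> / 2)\<^sup>2 + 0\<^sup>2)"
      unfolding curl_graph_norm_def by (rule real_sqrt_sum_squares_triangle_ineq)
    also have "\<dots> < \<epsilon>" using p\<phi> e by simp
    also have "(\<lambda>x. ?a x - ?h x) = (\<lambda>x. p x - g x - (\<phi> x - gradient u x))"
      by (simp add: fun_eq_iff)
    finally have "curl_graph_norm \<Omega> (\<lambda>x. p x - g x - (\<phi> x - gradient u x)) < \<epsilon>" .
    then show ?thesis
      using \<phi> u by (intro bexI[of _ "\<lambda>x. \<phi> x - gradient u x"])
        (auto intro: test_functions_diff gradient_test_function)
  qed
  ultimately show ?thesis by (simp add: H0_curl_def)
qed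

section \<open>The fundamental lemma of the calculus of variations\<close>

text \<open>
  For \<open>p = 1\<close> this is the standard smooth function that is flat at \<open>0\<close>. The polynomial factor
  makes the family closed under differentiation, which turns smoothness into an induction.
\<close>

definition flat_exp :: "real poly \<Rightarrow> real \<Rightarrow> real" where
  "flat_exp p t = (if t > 0 then poly p (1 / t) * exp (- (1 / t)) else 0)"

lemma poly_times_exp_minus_tendsto_0:
  fixes p :: "real poly"
  shows "((\<lambda>y. poly p y * exp (- y)) \<longlongrightarrow> 0) at_top"
proof -
  have "((\<lambda>y::real. \<Sum>i\<le>degree p. coeff p i * (y ^ i / exp y)) \<longlongrightarrow> (\<Sum>i\<le>degree p. coeff p i * 0)) at_top"
    by (intro tendsto_sum tendsto_mult tendsto_const tendsto_power_div_exp_0)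
  then show ?thesis
    by (simp add: poly_altdef exp_minus divide_inverse sum_distrib_right mult.assoc)
qed

lemma flat_exp_has_derivative:
  "(flat_exp p has_real_derivative flat_exp ([:0, 0, 1:] * (p - pderiv p)) t) (at t)"
proof -
  let ?q = "[:0, 0, 1:] * (p - pderiv p)"
  consider "t > 0" | "t < 0" | "t = 0" by linarith
  then show ?thesis
  proof cases
    case 1
    have "((\<lambda>t. poly p (1 / t) * exp (- (1 / t))) has_real_derivative flat_exp ?q t) (at t)"
      using 1 by (auto intro!: derivative_eq_intros DERIV_chain2[OF poly_DERIV]
          simp: flat_exp_def field_simps power2_eq_square)
    then show ?thesis
      by (rule has_field_derivative_transform_within_open[where S = "{0<..}"])
        (use 1 in \<open>auto simp: flat_exp_def\<close>)
  next
    case 2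
    have "((\<lambda>t. 0) has_real_derivative flat_exp ?q t) (at t)"
      using 2 by (simp add: flat_exp_def)
    then show ?thesis
      by (rule has_field_derivative_transform_within_open[where S = "{..<0}"])
        (use 2 in \<open>auto simp: flat_exp_def\<close>)
  next
    case 3
    have "((\<lambda>h. flat_exp p h / h) \<longlongrightarrow> 0) (at_right 0)"
    proof -
      have "((\<lambda>h. poly ([:0, 1:] * p) (inverse h) * exp (- inverse h)) \<longlongrightarrow> 0) (at_right 0)"
        using filterlim_compose[OF poly_times_exp_minus_tendsto_0 filterlim_inverse_at_top_right] .
      then show ?thesis
        by (rule Lim_transform_eventually)
          (auto simp: eventually_at_right_less flat_exp_def field_simps
            intro!: eventually_mono[OF eventually_at_right_less])
    qed
    moreover have "((\<lambda>h. flat_exp p h / h) \<longlongrightarrow> 0) (at_left 0)"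
      by (rule tendsto_eventually) (auto simp: flat_exp_def eventually_at_left_field intro: exI[of _ "-1"])
    ultimately have "((\<lambda>h. flat_exp p h / h) \<longlongrightarrow> 0) (at 0)"
      by (rule filterlim_split_at[rotated])
    then show ?thesis
      using 3 by (simp add: has_field_derivative_iff flat_exp_def)
  qed
qed

lemma C_k_flat_exp_affine: "C_k k (\<lambda>x. flat_exp p (c * x $ i + d))"
proof (induction k arbitrary: p)
  case 0
  have "continuous_on UNIV (flat_exp p)"
    using flat_exp_has_derivative by (intro DERIV_continuous_on) (rule has_field_derivative_at_within)
  then show ?case
    by (auto intro!: continuous_on_compose2[of UNIV "flat_exp p"] continuous_intros)
next
  case (Suc k)
  let ?q = "[:0, 0, 1:] * (p - pderiv p)"
  have D: "((\<lambda>x. flat_exp p (c * x $ i + d)) has_derivative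
      (\<lambda>h. (c * h $ i) * flat_exp ?q (c * x $ i + d))) (at x)" for x
  proof -
    have "((\<lambda>x. c * x $ i + d) has_derivative (\<lambda>h. c * h $ i)) (at x)"
      by (auto intro!: derivative_eq_intros bounded_linear.has_derivative[OF bounded_linear_vec_nth])
    from has_derivative_compose[OF this flat_exp_has_derivative[THEN has_field_derivative_imp_has_derivative]]
    show ?thesis by (simp add: mult.commute)
  qed
  have "partial_deriv j (\<lambda>x. flat_exp p (c * x $ i + d))
      = (\<lambda>x. (c * axis j 1 $ i) * flat_exp ?q (c * x $ i + d))" for j
    by (rule ext, subst partial_deriv_eqI[OF D]) simp
  then show ?case
    using differentiableI[OF D] C_k_bounded_linear[OF bounded_linear_mult_right Suc.IH] by simp
qed

text \<open>
  The factors vanish unless \<open>x $ i\<close> is at least \<open>1 / (k + 1)\<close> away from both ends of the interval, so the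
  support is a compact subset of the open box.
\<close>

definition box_bump :: "real ^ 'n \<Rightarrow> real ^ 'n \<Rightarrow> nat \<Rightarrow> real ^ 'n \<Rightarrow> real" where
  "box_bump a b k x = (\<Prod>i\<in>UNIV.
     flat_exp 1 (real (Suc k) * (x $ i - a $ i) - 1) * flat_exp 1 (real (Suc k) * (b $ i - x $ i) - 1))"

lemma flat_exp_1_bounds: "0 \<le> flat_exp 1 t" "flat_exp 1 t \<le> 1"
  by (auto simp: flat_exp_def)

lemma flat_exp_1_tendsto:
  assumes "\<delta> > 0"
  shows "(\<lambda>k. flat_exp 1 (real (Suc k) * \<delta> - 1)) \<longlonglongrightarrow> 1"
proof -
  have lim: "filterlim (\<lambda>k. real (Suc k) * \<delta> - 1) at_top sequentially"
  proof -
    have "filterlim (\<lambda>k. (- 1) + real (Suc k) * \<delta>) at_top sequentially"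
      by (intro filterlim_tendsto_add_at_top[OF tendsto_const]
          filterlim_at_top_mult_tendsto_pos[OF tendsto_const assms]
          filterlim_compose[OF filterlim_real_sequentially filterlim_Suc])
    then show ?thesis by simp
  qed
  have "((\<lambda>t::real. exp (- (1 / t))) \<longlongrightarrow> exp (- 0)) at_top"
    by (intro tendsto_exp tendsto_minus tendsto_divide_0[OF tendsto_const] filterlim_at_top_imp_at_infinity filterlim_ident)
  moreover have "\<forall>\<^sub>F t in at_top. exp (- (1 / t)) = flat_exp 1 t"
    using eventually_gt_at_top[of 0] by eventually_elim (simp add: flat_exp_def)
  ultimately have "(flat_exp 1 \<longlongrightarrow> exp (- 0)) at_top"
    by (rule Lim_transform_eventually)
  then have "(flat_exp 1 \<longlongrightarrow> 1) at_top" by simp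
  from filterlim_compose[OF this lim] show ?thesis .
qed

lemma box_bump_bounds: "0 \<le> box_bump a b k x" "box_bump a b k x \<le> 1"
  unfolding box_bump_def
  by (auto intro!: prod_nonneg prod_le_1 mult_nonneg_nonneg mult_le_one flat_exp_1_bounds)

lemma box_bump_eq_0:
  assumes "real (Suc k) * (x $ i - a $ i) \<le> 1 \<or> real (Suc k) * (b $ i - x $ i) \<le> 1"
  shows "box_bump a b k x = 0"
proof -
  have "flat_exp 1 (real (Suc k) * (x $ i - a $ i) - 1)
      * flat_exp 1 (real (Suc k) * (b $ i - x $ i) - 1) = 0"
    using assms by (auto simp: flat_exp_def simp del: of_nat_Suc)
  then show ?thesis
    unfolding box_bump_def by (intro prod_zero finite bexI[of _ i]) auto
qed

lemma box_bump_test_function: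
  assumes "box a b \<subseteq> \<Omega>"
  shows "box_bump a b k \<in> test_functions \<Omega>"
proof (rule test_functionsI)
  let ?s = "real (Suc k)"
  let ?K = "cbox (\<chi> i. a $ i + 1 / ?s) (\<chi> i. b $ i - 1 / ?s)"
  have "C_k l (\<lambda>x. flat_exp 1 (?s * x $ i + (- (?s * a $ i) - 1))
      * flat_exp 1 ((- ?s) * x $ i + (?s * b $ i - 1)))" for i l
    by (intro C_k_mult C_k_flat_exp_affine)
  then have "C_k l (\<lambda>x. flat_exp 1 (?s * (x $ i - a $ i) - 1) * flat_exp 1 (?s * (b $ i - x $ i) - 1))" for i l
    by (simp add: algebra_simps)
  then show "C_k l (box_bump a b k)" for l
    unfolding box_bump_def[abs_def] by (intro C_k_prod) auto
  show "compact ?K" by simp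
  have "?K \<subseteq> box a b"
  proof
    fix x assume x: "x \<in> ?K"
    have "1 / ?s > 0" by simp
    moreover have "a $ i + 1 / ?s \<le> x $ i \<and> x $ i \<le> b $ i - 1 / ?s" for i
      using x by (simp add: mem_box_cart del: of_nat_Suc)
    ultimately have "a $ i < x $ i \<and> x $ i < b $ i" for i
      by (smt (verit))
    then show "x \<in> box a b" by (simp add: mem_box_cart)
  qed
  then show "?K \<subseteq> \<Omega>" using assms by blast
  fix x assume "x \<notin> ?K"
  then obtain i where "x $ i < a $ i + 1 / ?s \<or> x $ i > b $ i - 1 / ?s"
    by (auto simp: mem_box_cart not_le)
  then have "?s * (x $ i - a $ i) \<le> 1 \<or> ?s * (b $ i - x $ i) \<le> 1"
    by (auto simp: field_simps)
  then show "box_bump a b k x = 0" by (rule box_bump_eq_0)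
qed

lemma box_bump_tendsto: "(\<lambda>k. box_bump a b k x) \<longlonglongrightarrow> indicator (box a b) x"
proof (cases "x \<in> box a b")
  case True
  have "(\<lambda>k. box_bump a b k x) \<longlonglongrightarrow> (\<Prod>i\<in>(UNIV :: 'a set). 1 * 1)"
    unfolding box_bump_def
    using True by (intro tendsto_prod tendsto_mult flat_exp_1_tendsto) (auto simp: mem_box_cart)
  then show ?thesis using True by simp
next
  case False
  then obtain i where i: "x $ i - a $ i \<le> 0 \<or> b $ i - x $ i \<le> 0"
    by (auto simp: mem_box_cart not_less)
  have "real (Suc k) * \<delta> \<le> 1" if "\<delta> \<le> 0" for \<delta> :: real and k
    using mult_nonneg_nonpos[of "real (Suc k)" \<delta>] that by linarith
  then have "box_bump a b k x = 0" for k
    using i by (intro box_bump_eq_0) blast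
  then show ?thesis using False by simp
qed

text \<open>
  The smooth functions \<open>box_bump\<close> converge boundedly to the indicator of a box, so the integral of
  \<open>f\<close> over every open box inside \<open>\<Omega>\<close> vanishes. Within one such box, the boxes form an
  intersection-stable generator of the Borel sets, hence all integrals of \<open>f\<close> over Borel subsets vanish and
  \<open>f\<close> is zero almost everywhere there. Countably many boxes cover \<open>\<Omega>\<close>.
\<close>

lemma fundamental_lemma_variations:
  fixes f :: "real ^ 'n \<Rightarrow> real"
  assumes \<Omega>: "open \<Omega>" and int: "integrable (lebesgue_on \<Omega>) f"
    and zero: "\<And>\<phi>. \<phi> \<in> test_functions \<Omega> \<Longrightarrow> (LINT x|lebesgue_on \<Omega>. f x * \<phi> x) = 0"
  shows "AE x in lebesgue_on \<Omega>. f x = 0"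
proof -
  have \<Omega>s: "\<Omega> \<in> sets lebesgue" using \<Omega> by simp
  have box0: "(LINT x|lebesgue_on \<Omega>. f x * indicator (box a b) x) = 0" if sub: "box a b \<subseteq> \<Omega>" for a b
  proof -
    have "(\<lambda>k. LINT x|lebesgue_on \<Omega>. f x * box_bump a b k x)
        \<longlonglongrightarrow> (LINT x|lebesgue_on \<Omega>. f x * indicator (box a b) x)"
    proof (rule integral_dominated_convergence)
      show "integrable (lebesgue_on \<Omega>) (\<lambda>x. \<bar>f x\<bar>)" using int by simp
      have ind: "indicator (box a b) \<in> borel_measurable (lebesgue_on \<Omega>)"
        by (intro borel_measurable_indicator) (use \<Omega>s in \<open>auto simp: sets_restrict_space_iff sub\<close>)
      show "(\<lambda>x. f x * indicator (box a b) x) \<in> borel_measurable (lebesgue_on \<Omega>)"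
        using int ind by (intro borel_measurable_times) auto
      have "box_bump a b k \<in> borel_measurable (lebesgue_on \<Omega>)" for k
        using test_functions_continuous[OF box_bump_test_function[OF sub]] \<Omega>s
        by (intro continuous_imp_measurable_on_sets_lebesgue) (auto intro: continuous_on_subset)
      then show "(\<lambda>x. f x * box_bump a b k x) \<in> borel_measurable (lebesgue_on \<Omega>)" for k
        using int by (intro borel_measurable_times) auto
      show "AE x in lebesgue_on \<Omega>. (\<lambda>k. f x * box_bump a b k x) \<longlonglongrightarrow> f x * indicator (box a b) x"
        by (intro AE_I2 tendsto_mult tendsto_const box_bump_tendsto)
      show "AE x in lebesgue_on \<Omega>. norm (f x * box_bump a b k x) \<le> \<bar>f x\<bar>" for k
        by (intro AE_I2) (simp add: abs_mult box_bump_bounds mult_left_le)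
    qed
    moreover have "(LINT x|lebesgue_on \<Omega>. f x * box_bump a b k x) = 0" for k
      using box_bump_test_function[OF sub] by (rule zero)
    ultimately show ?thesis by (simp add: LIMSEQ_const_iff)
  qed
  \<comment> \<open>The extension of \<open>f\<close> by zero is replaced by a Borel representative \<open>G\<close>, since the generator
      argument concerns Borel sets only.\<close>
  define F where "F = (\<lambda>x. indicator \<Omega> x *\<^sub>R f x)"
  have F: "integrable lebesgue F"
    using int \<Omega>s by (simp add: F_def integrable_restrict_space)
  obtain G where Gm: "G \<in> borel_measurable lborel" and FG: "AE x in lborel. F x = G x"
    using completion_ex_borel_measurable_real[OF borel_measurable_integrable[OF F]] by blast
  have FG': "AE x in lebesgue. F x = G x" using FG by (rule AE_completion)
  have G: "integrable lborel G"
  proof -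
    have "integrable lebesgue G"
      using F FG' Gm by (subst integrable_cong_AE[of _ _ F]) (auto intro: measurable_completion)
    then show ?thesis using Gm by (simp add: integrable_completion)
  qed
  have Gbox: "(LINT x|lborel. indicator (box a b) x * G x) = 0" if sub: "box a b \<subseteq> \<Omega>" for a b
  proof -
    have m: "(\<lambda>x. indicator (box a b) x * G x) \<in> borel_measurable lborel"
      using Gm by measurable
    have "(LINT x|lborel. indicator (box a b) x * G x) = (LINT x|lebesgue. indicator (box a b) x * G x)"
      using m by (simp add: integral_completion)
    also have "\<dots> = (LINT x|lebesgue. indicator (box a b) x * F x)"
      using FG' F measurable_completion[OF Gm]
      by (intro integral_cong_AE borel_measurable_times borel_measurable_indicator) auto
    also have "\<dots> = (LINT x|lebesgue. indicator \<Omega> x *\<^sub>R (f x * indicator (box a b) x))"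
      by (intro Bochner_Integration.integral_cong) (auto simp: F_def)
    also have "\<dots> = (LINT x|lebesgue_on \<Omega>. f x * indicator (box a b) x)"
      using \<Omega>s by (simp add: integral_restrict_space)
    also have "\<dots> = 0" using sub by (rule box0)
    finally show ?thesis .
  qed
  have G0: "AE x in lborel. x \<in> box a b \<longrightarrow> G x = 0" if sub: "box a b \<subseteq> \<Omega>" for a b
  proof -
    let ?H = "\<lambda>x. indicator (box a b) x * G x"
    have H: "integrable lborel ?H"
      using G by (intro integrable_mult_indicator[where 'b = real, unfolded real_scaleR_def]) auto
    have "set_lebesgue_integral lborel A ?H = 0" if "A \<in> sets lborel" for A
    proof -
      let ?E = "range (\<lambda>(c, d). box c d :: (real ^ 'n) set)"
      have borel: "sets lborel = sigma_sets UNIV ?E"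
        by (simp add: borel_eq_box)
      have Hs: "set_integrable lborel B ?H" if "B \<in> sigma_sets UNIV ?E" for B
        unfolding set_integrable_def using that H borel by (intro integrable_mult_indicator) auto
      \<comment> \<open>The whole space counts as the box \<open>box a b\<close> itself, which settles complements.\<close>
      have total: "(LINT x|lborel. ?H x) = 0" using Gbox[OF sub] .
      have "Int_stable ?E" by (auto simp: Int_stable_def box_Int_box)
      moreover have "?E \<subseteq> Pow UNIV" by simp
      moreover have "A \<in> sigma_sets UNIV ?E" using that borel by simp
      ultimately show ?thesis
      proof (induction rule: sigma_sets_induct_disjoint)
        case (basic A)
        then obtain c d where A: "A = box c d" by auto
        obtain u v where uv: "box c d \<inter> box a b = box u v" by (simp add: box_Int_box)
        have "box u v \<subseteq> \<Omega>" using uv sub by blast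
        moreover have "(\<lambda>x. indicator A x *\<^sub>R ?H x) = (\<lambda>x. indicator (box u v) x * G x)"
          by (auto simp: fun_eq_iff A indicator_def uv[symmetric])
        ultimately show ?case
          unfolding set_lebesgue_integral_def using Gbox by presburger
      next
        case empty
        show ?case by (simp add: set_lebesgue_integral_def)
      next
        case (compl A)
        have "indicator (UNIV - A) x *\<^sub>R ?H x = ?H x - indicator A x *\<^sub>R ?H x" for x
          by (auto simp: indicator_def)
        then show ?case
          using compl(2) Hs[OF compl(1)] H total
          by (simp add: set_lebesgue_integral_def set_integrable_def)
      next
        case (union A)
        have "(\<Union>i. A i) \<in> sigma_sets UNIV ?E"
          using union(2) by (intro sigma_sets.Union) auto
        then have "set_lebesgue_integral lborel (\<Union>i. A i) ?H
            = (\<Sum>i. set_lebesgue_integral lborel (A i) ?H)"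
          using union(1,2) Hs borel
          by (intro lebesgue_integral_countable_add) (auto simp: disjoint_family_on_def)
        then show ?case using union(3) by simp
      qed
    qed
    from sigma_finite_measure.density_zero[OF lborel.sigma_finite_measure_axioms H this] show ?thesis
      by (auto simp: indicator_def)
  qed
  obtain \<D> where \<D>: "countable \<D>" "\<D> \<subseteq> Pow \<Omega>" "\<And>X. X \<in> \<D> \<Longrightarrow> \<exists>a b. X = box a b" "\<Union>\<D> = \<Omega>"
    by (rule open_countable_Union_open_box[OF \<Omega>]) blast
  have "AE x in lborel. \<forall>X\<in>\<D>. x \<in> X \<longrightarrow> G x = 0"
    using \<D>(1)
  proof (rule AE_ball_countable[THEN iffD2], intro ballI)
    fix X assume X: "X \<in> \<D>"
    then obtain a b where "X = box a b" using \<D>(3) by blast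
    with X \<D>(2) G0 show "AE x in lborel. x \<in> X \<longrightarrow> G x = 0" by blast
  qed
  with FG have "AE x in lborel. x \<in> \<Omega> \<longrightarrow> f x = 0"
  proof eventually_elim
    case (elim x)
    show ?case
    proof
      assume x: "x \<in> \<Omega>"
      then have "G x = 0" using elim(2) \<D>(4) by blast
      with elim(1) x show "f x = 0" by (simp add: F_def)
    qed
  qed
  then show ?thesis
    using \<Omega>s by (simp add: AE_restrict_space_iff AE_completion)
qed

text \<open>
  The constant zero is one weak divergence of \<open>s\<close>; the field selected by \<open>weak_div\<close> may be another
  one, but it is orthogonal to all test functions as well.
\<close>

lemma weak_div_norm_eq_0:
  assumes \<Omega>: "open \<Omega>" "\<Omega> \<in> lmeasurable" and s: "has_weak_div \<Omega> s (\<lambda>x. 0)"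
  shows "L2_norm \<Omega> (weak_div \<Omega> s) = 0"
proof -
  have "(\<lambda>x. 0) \<in> L2 \<Omega>" by (simp add: L2_def)
  with s have d: "weak_div \<Omega> s \<in> L2 \<Omega> \<and> has_weak_div \<Omega> s (weak_div \<Omega> s)"
    unfolding weak_div_def by (intro someI[of "\<lambda>d. d \<in> L2 \<Omega> \<and> has_weak_div \<Omega> s d"]) simp
  have "AE x in lebesgue_on \<Omega>. weak_div \<Omega> s x = 0"
  proof (rule fundamental_lemma_variations[OF \<Omega>(1)])
    show "integrable (lebesgue_on \<Omega>) (weak_div \<Omega> s)"
      using integrable_inner_L2[OF d[THEN conjunct1] const_in_L2[OF \<Omega>(2), of 1]] by simp
    show "(LINT x|lebesgue_on \<Omega>. weak_div \<Omega> s x * \<phi> x) = 0" if "\<phi> \<in> test_functions \<Omega>" for \<phi>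
      using d s that by (simp add: has_weak_div_def)
  qed
  then show ?thesis by (rule L2_norm_cong_ae_zero)
qed

section \<open>Korn's first inequality\<close>

lemma linear_transpose: "linear (transpose :: real ^ 'n ^ 'm \<Rightarrow> real ^ 'm ^ 'n)"
  by (rule linearI) (simp_all add: transpose_def vec_eq_iff)

lemma linear_sym_part: "linear (sym_part :: real ^ 'n ^ 'n \<Rightarrow> _)"
  by (rule linearI) (simp_all add: sym_part_def transpose_def vec_eq_iff algebra_simps)

lemma inner_transpose_transpose:
  fixes A B :: "real ^ 'n ^ 'm"
  shows "transpose A \<bullet> transpose B = A \<bullet> B"
  unfolding inner_vec_def transpose_def by (subst sum.swap) simp

lemma power2_norm_sym_part:
  fixes A :: "real ^ 'n ^ 'n"
  shows "(norm (sym_part A))\<^sup>2 = (1 / 2) * (A \<bullet> A) + (1 / 2) * (A \<bullet> transpose A)"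
proof -
  have "(norm (sym_part A))\<^sup>2 = (1 / 4) * (norm (A + transpose A))\<^sup>2"
    by (simp add: sym_part_def power_divide)
  also have "\<dots> = (1 / 4) * (A \<bullet> A + 2 * (A \<bullet> transpose A) + transpose A \<bullet> transpose A)"
    by (simp add: power2_norm_eq_inner inner_add_left inner_add_right inner_commute)
  finally have "(norm (sym_part A))\<^sup>2
      = (1 / 4) * (A \<bullet> A + 2 * (A \<bullet> transpose A) + transpose A \<bullet> transpose A)" .
  then show ?thesis by (simp add: inner_transpose_transpose)
qed

lemma norm_sym_part_le:
  fixes A :: "real ^ 'n ^ 'n"
  shows "norm (sym_part A) \<le> norm A"
proof -
  have "norm (transpose A) = norm A"
    by (simp add: norm_eq_sqrt_inner inner_transpose_transpose)
  then show ?thesis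
    using norm_triangle_ineq[of A "transpose A"] by (simp add: sym_part_def)
qed

text \<open>
  Twice the squared norm of \<open>sym A\<close> exceeds the squared norm of \<open>A\<close> by the integral of
  \<open>\<Sum>\<^sub>i\<^sub>j A\<^sub>i\<^sub>j A\<^sub>j\<^sub>i\<close>. Exchanging the column indices, which is \<open>L2_gradients_swap\<close> for the rows \<open>i\<close>
  and \<open>j\<close>, turns this integral into that of \<open>(tr A)\<^sup>2\<close>, which is nonnegative.
\<close>

lemma Korn_L2_gradients:
  fixes A :: "real ^ 'n \<Rightarrow> real ^ 'n ^ 'n"
  assumes \<Omega>: "\<Omega> \<in> lmeasurable" and A: "\<And>i. (\<lambda>x. A x $ i) \<in> L2_gradients \<Omega>"
  shows "(L2_norm \<Omega> A)\<^sup>2 \<le> 2 * (L2_norm \<Omega> (\<lambda>x. sym_part (A x)))\<^sup>2"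
proof -
  let ?M = "lebesgue_on \<Omega>"
  have rows: "(\<lambda>x. A x $ i) \<in> L2 \<Omega>" for i using A by (rule L2_gradients_L2)
  have AL: "A \<in> L2 \<Omega>" using L2_vec[of "\<lambda>i x. A x $ i", OF rows] by simp
  have TL: "(\<lambda>x. transpose (A x)) \<in> L2 \<Omega>" using linear_transpose AL by (rule L2_linear_image)
  have int: "integrable ?M (\<lambda>x. A x $ i $ k * A x $ j $ l)" for i j k l
    using integrable_inner_L2[OF L2_component[OF rows[of i], of k] L2_component[OF rows[of j], of l]]
    by simp
  have "L2_inner \<Omega> A (\<lambda>x. transpose (A x))
      = (LINT x|?M. (\<Sum>i\<in>UNIV. \<Sum>j\<in>UNIV. A x $ i $ j * A x $ j $ i))"
    by (simp add: L2_inner_def inner_vec_def transpose_def)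
  also have "\<dots> = (\<Sum>i\<in>UNIV. \<Sum>j\<in>UNIV. LINT x|?M. A x $ i $ j * A x $ j $ i)"
    by (simp add: int)
  also have "\<dots> = (\<Sum>i\<in>UNIV. \<Sum>j\<in>UNIV. LINT x|?M. A x $ i $ i * A x $ j $ j)"
    by (intro sum.cong refl L2_gradients_swap[OF \<Omega> A A])
  also have "\<dots> = (LINT x|?M. (\<Sum>i\<in>UNIV. \<Sum>j\<in>UNIV. A x $ i $ i * A x $ j $ j))"
    by (simp add: int)
  also have "\<dots> = (LINT x|?M. (\<Sum>i\<in>UNIV. A x $ i $ i)\<^sup>2)"
    by (simp add: power2_eq_square sum_product)
  finally have cross: "0 \<le> L2_inner \<Omega> A (\<lambda>x. transpose (A x))" by simp
  have "(L2_norm \<Omega> (\<lambda>x. sym_part (A x)))\<^sup>2 = (LINT x|?M. (norm (sym_part (A x)))\<^sup>2)"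
    by (simp add: L2_norm_def)
  also have "\<dots> = (1 / 2) * L2_inner \<Omega> A A + (1 / 2) * L2_inner \<Omega> A (\<lambda>x. transpose (A x))"
    unfolding power2_norm_sym_part
    using integrable_inner_L2[OF AL AL] integrable_inner_L2[OF AL TL] by (simp add: L2_inner_def)
  finally have "(L2_norm \<Omega> (\<lambda>x. sym_part (A x)))\<^sup>2
      = (1 / 2) * (L2_norm \<Omega> A)\<^sup>2 + (1 / 2) * L2_inner \<Omega> A (\<lambda>x. transpose (A x))"
    by (simp add: power2_L2_norm)
  with cross show ?thesis by simp
qed

section \<open>The Maxwell-Korn inequality\<close>

text \<open>
  The squared inequality with separate constants. The coefficient \<open>5\<close> consists of \<open>4\<close> from estimating
  \<open>sym S\<close> inside \<open>sym G = sym P - sym S\<close> and \<open>1\<close> from the orthogonal summand \<open>S\<close> itself.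
\<close>

lemma Maxwell_Korn:
  fixes \<Omega> :: "'n::{finite,linorder} point set" and P :: "'n point \<Rightarrow> 'n matrix"
  assumes \<Omega>: "open \<Omega>" "\<Omega> \<in> lmeasurable" and c: "c \<ge> 0"
    and Maxwell: "\<And>v. v \<in> H0_curl \<Omega> \<inter> H_div \<Omega> \<Longrightarrow> L2_norm \<Omega> v
        \<le> c * sqrt ((L2_norm \<Omega> (weak_curl \<Omega> v))\<^sup>2 + (L2_norm \<Omega> (weak_div \<Omega> v))\<^sup>2)"
    and P: "P \<in> H0_Curl \<Omega>"
  shows "(L2_norm \<Omega> P)\<^sup>2
    \<le> 4 * (L2_norm \<Omega> (\<lambda>x. sym_part (P x)))\<^sup>2 + 5 * c\<^sup>2 * (L2_norm \<Omega> (weak_Curl \<Omega> P))\<^sup>2"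
proof -
  have rowH: "(\<lambda>x. P x $ n) \<in> H0_curl \<Omega>" for n using P by (simp add: H0_Curl_def)
  then have rowHc: "(\<lambda>x. P x $ n) \<in> H_curl \<Omega>" for n by (simp add: H0_curl_def)
  then have row: "(\<lambda>x. P x $ n) \<in> L2 \<Omega>" for n by (simp add: H_curl_def)
  have PL: "P \<in> L2 \<Omega>" using L2_vec[of "\<lambda>n x. P x $ n", OF row] by simp
  have "\<exists>g. g \<in> L2_gradients \<Omega> \<and>
      (\<forall>w\<in>test_functions \<Omega>. L2_inner \<Omega> (\<lambda>x. P x $ n - g x) (gradient w) = 0)" for n
    by (rule L2_gradient_projection[OF \<Omega>(2) row[of n]]) blast
  then obtain g where g: "\<And>n. g n \<in> L2_gradients \<Omega>"
    and orth: "\<And>n w. w \<in> test_functions \<Omega> \<Longrightarrow> L2_inner \<Omega> (\<lambda>x. P x $ n - g n x) (gradient w) = 0"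
    by metis
  define G where "G = (\<lambda>x. \<chi> n. g n x)"
  define S where "S = (\<lambda>x. P x - G x)"
  have GL: "G \<in> L2 \<Omega>" unfolding G_def using g by (intro L2_vec L2_gradients_L2)
  have SL: "S \<in> L2 \<Omega>" unfolding S_def using PL GL by (rule L2_diff)
  have Srow: "(\<lambda>x. S x $ n) = (\<lambda>x. P x $ n - g n x)" for n by (simp add: S_def G_def)
  have GS: "L2_inner \<Omega> G S = 0"
  proof -
    have "L2_inner \<Omega> (g n) (\<lambda>x. S x $ n) = 0" for n
    proof (rule L2_gradients_inner_eq_0[OF \<Omega>(2) L2_component[OF SL] g])
      show "L2_inner \<Omega> (gradient w) (\<lambda>x. S x $ n) = 0" if "w \<in> test_functions \<Omega>" for w
        using orth[OF that, of n] by (subst L2_inner_commute) (simp only: Srow)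
    qed
    then show ?thesis
      using L2_inner_vec[OF GL SL] by (simp add: G_def)
  qed
  have split: "(L2_norm \<Omega> P)\<^sup>2 = (L2_norm \<Omega> G)\<^sup>2 + (L2_norm \<Omega> S)\<^sup>2"
    using power2_L2_norm_add_scaleR[OF GL SL, of 1] GS by (simp add: S_def)
  have curlL: "weak_curl \<Omega> (\<lambda>x. P x $ n) \<in> L2 \<Omega>" for n
  proof -
    have "\<exists>w. w \<in> L2 \<Omega> \<and> has_weak_curl \<Omega> (\<lambda>x. P x $ n) w"
      using rowHc[of n] by (auto simp: H_curl_def)
    from someI_ex[OF this] show ?thesis by (simp add: weak_curl_def)
  qed
  have rowS: "(L2_norm \<Omega> (\<lambda>x. S x $ n))\<^sup>2 \<le> c\<^sup>2 * (L2_norm \<Omega> (weak_curl \<Omega> (\<lambda>x. P x $ n)))\<^sup>2" for n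
  proof -
    have div: "has_weak_div \<Omega> (\<lambda>x. S x $ n) (\<lambda>x. 0)"
      using orth by (intro has_weak_div_0_if_orthogonal) (simp add: Srow)
    have "(\<lambda>x. 0) \<in> L2 \<Omega>" by (simp add: L2_def)
    then have "(\<lambda>x. S x $ n) \<in> H_div \<Omega>"
      using div L2_component[OF SL, of n] by (auto simp: H_div_def)
    moreover have "(\<lambda>x. S x $ n) \<in> H0_curl \<Omega>"
      unfolding Srow using \<Omega>(2) rowH g by (rule H0_curl_diff_gradient)
    ultimately have "L2_norm \<Omega> (\<lambda>x. S x $ n) \<le> c * L2_norm \<Omega> (weak_curl \<Omega> (\<lambda>x. S x $ n))"
      using Maxwell[of "\<lambda>x. S x $ n"] weak_div_norm_eq_0[OF \<Omega> div] by simp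
    from power_mono[OF this, of 2] show ?thesis
      unfolding Srow weak_curl_diff_gradient[OF \<Omega>(2) row g] by (simp add: power_mult_distrib)
  qed
  have "(L2_norm \<Omega> S)\<^sup>2 \<le> c\<^sup>2 * (L2_norm \<Omega> (weak_Curl \<Omega> P))\<^sup>2"
  proof -
    have "(L2_norm \<Omega> S)\<^sup>2 \<le> (\<Sum>n\<in>UNIV. c\<^sup>2 * (L2_norm \<Omega> (weak_curl \<Omega> (\<lambda>x. P x $ n)))\<^sup>2)"
      unfolding power2_L2_norm_vec[OF SL] by (intro sum_mono rowS)
    also have "\<dots> = c\<^sup>2 * (L2_norm \<Omega> (weak_Curl \<Omega> P))\<^sup>2"
      using power2_L2_norm_vec[OF L2_vec[of "\<lambda>n. weak_curl \<Omega> (\<lambda>x. P x $ n)", OF curlL]]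
      by (simp add: weak_Curl_def[abs_def] sum_distrib_left)
    finally show ?thesis .
  qed
  moreover have "(L2_norm \<Omega> G)\<^sup>2 \<le> 4 * (L2_norm \<Omega> (\<lambda>x. sym_part (P x)))\<^sup>2 + 4 * (L2_norm \<Omega> S)\<^sup>2"
  proof -
    have symL: "(\<lambda>x. sym_part (P x)) \<in> L2 \<Omega>" "(\<lambda>x. sym_part (S x)) \<in> L2 \<Omega>"
      using PL SL by (auto intro: L2_linear_image[OF linear_sym_part])
    have "(\<lambda>x. sym_part (G x)) = (\<lambda>x. sym_part (P x) - sym_part (S x))"
      by (simp add: S_def linear_diff[OF linear_sym_part, symmetric])
    then have "L2_norm \<Omega> (\<lambda>x. sym_part (G x))
        \<le> L2_norm \<Omega> (\<lambda>x. sym_part (P x)) + L2_norm \<Omega> (\<lambda>x. sym_part (S x))"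
      using L2_triangle_diff[OF symL] by simp
    also have "\<dots> \<le> L2_norm \<Omega> (\<lambda>x. sym_part (P x)) + L2_norm \<Omega> S"
      using L2_norm_mono[OF symL(2) SL norm_sym_part_le] by simp
    finally have "(L2_norm \<Omega> (\<lambda>x. sym_part (G x)))\<^sup>2
        \<le> (L2_norm \<Omega> (\<lambda>x. sym_part (P x)) + L2_norm \<Omega> S)\<^sup>2"
      by (rule power_mono) simp
    also have "\<dots> \<le> 2 * (L2_norm \<Omega> (\<lambda>x. sym_part (P x)))\<^sup>2 + 2 * (L2_norm \<Omega> S)\<^sup>2"
      using sum_squares_bound[of "L2_norm \<Omega> (\<lambda>x. sym_part (P x))" "L2_norm \<Omega> S"]
      by (simp add: power2_sum)
    finally show ?thesis
      using Korn_L2_gradients[OF \<Omega>(2), of G] g by (simp add: G_def)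
  qed
  ultimately show ?thesis using split by simp
qed

theorem lemma12:
  fixes \<Omega> :: "(real ^ 'n::{finite,linorder}) set" and c\<^sub>m :: real
  assumes "bounded_domain \<Omega>"
    and "connected (frontier \<Omega>)"
    and "lipschitz_boundary \<Omega>"
    and "c\<^sub>m > 0"
    and "\<forall>v \<in> H0_curl \<Omega> \<inter> H_div \<Omega>.
      L2_norm \<Omega> v
        \<le> c\<^sub>m * sqrt ((L2_norm \<Omega> (weak_curl \<Omega> v))\<^sup>2 + (L2_norm \<Omega> (weak_div \<Omega> v))\<^sup>2)"
  shows "\<forall>P \<in> H0_Curl \<Omega>.
      L2_norm \<Omega> P
        \<le> max 2 (sqrt 5 * c\<^sub>m)
           * sqrt ((L2_norm \<Omega> (\<lambda>x. sym_part (P x)))\<^sup>2 + (L2_norm \<Omega> (weak_Curl \<Omega> P))\<^sup>2)"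
proof
  fix P assume P: "P \<in> H0_Curl \<Omega>"
  let ?a = "(L2_norm \<Omega> (\<lambda>x. sym_part (P x)))\<^sup>2" and ?k = "(L2_norm \<Omega> (weak_Curl \<Omega> P))\<^sup>2"
  let ?M = "max 2 (sqrt 5 * c\<^sub>m)"
  have op: "open \<Omega>" and lm: "\<Omega> \<in> lmeasurable"
    using assms(1) by (auto simp: bounded_domain_def intro: lmeasurable_open)
  have "(L2_norm \<Omega> P)\<^sup>2 \<le> 4 * ?a + 5 * c\<^sub>m\<^sup>2 * ?k"
    using assms(4,5) P by (intro Maxwell_Korn[OF op lm]) auto
  also have "\<dots> \<le> ?M\<^sup>2 * ?a + ?M\<^sup>2 * ?k"
  proof (intro add_mono mult_right_mono)
    have "(2::real)\<^sup>2 \<le> ?M\<^sup>2" "(sqrt 5 * c\<^sub>m)\<^sup>2 \<le> ?M\<^sup>2"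
      using assms(4) by (intro power_mono; simp)+
    then show "4 \<le> ?M\<^sup>2" "5 * c\<^sub>m\<^sup>2 \<le> ?M\<^sup>2"
      by (simp_all add: power_mult_distrib)
  qed simp_all
  also have "\<dots> = (?M * sqrt (?a + ?k))\<^sup>2"
    by (simp add: power_mult_distrib distrib_left)
  finally show "L2_norm \<Omega> P \<le> ?M * sqrt (?a + ?k)"
    by (rule power2_le_imp_le) simp
qed

end
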